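(* Let $f:S^n\to S^m$ be an LOMSE of Type (I), with associated angle $\theta$, and let the half-plane $\{(r,\rho): r>0,\ \rho\in\mathbb R\}$ be endowed with the canonical metric $$g_0=\sigma_0^2\,(r^2+\lambda^2\rho^2)^p\, r^{2(n-p)}\,(dr^2+d\rho^2).$$ Then there exists $\varphi_1>\tan\theta$ such that the LOC curve $\{\rho=\tan\theta\cdot r,\ r>0\}$ is length-minimizing with respect to $g_0$ in the angular region $$\mathscr S=\{(r,\rho): r>0,\ 0<\rho<\varphi_1 r\},$$ that is, the part of the LOC curve between any two of its points has $g_0$-length no greater than that of any piecewise $C^1$ curve in $\mathscr S$ joining these two points.
   Context: **Lawson–Osserman maps.** A smooth map $f:S^n\to S^m$ between unit spheres is a Lawson–Osserman map (LOM) if there is an acute angle $\theta\in(0,\pi/2)$ such that $M_{f,\theta}=\{(\cos\theta\, x,\ \sin\theta\, f(x)): x\in S^n\}$ is a minimal submanifold of the unit sphere $S^{m+n+1}\subset\mathbb R^{m+n+2}$. The cone over $M_{f,\theta}$ is the associated Lawson–Osserman cone (LOC). **LOMSE.** An LOM $f$ is an LOMSE if at each $x\in S^n$ all nonzero singular values of the differential $(f_* )_x:T_xS^n\to T_{f(x)}S^m$ (with respect to the standard round metrics) are equal, i.e. the set of singular values is $\{0,\lambda\}$ with $\lambda>0$. For an LOMSE it is known that $\lambda$ and the multiplicity $p$ of $\lambda$ (so $0$ has multiplicity $n-p>0$) do not depend on $x$; that $f=i\circ\pi$ where $\pi$ is a Hopf fibration from $S^n$ onto a complex, quaternionic or octonionic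 projective space $(\mathbb P^p,h)$ of real dimension $p$ and $i:(\mathbb P^p,\lambda^2h)\to S^m$ is a minimal isometric immersion; and that the $m+1$ components of $f$ are spherical harmonics of a common even degree $k$, with $\lambda=\sqrt{k(k+n-1)/p}$. One says $f$ is of $(n,p,k)$-type. The angle is then determined by $\tan^2\theta=\dfrac{p-n\lambda^{-2}}{n-p}$. **Type (I).** $f$ is of Type (I) if $(n,p,k)\in\{(3,2,2),(5,4,2),(5,4,4)\}$ or $n\ge 7$. **Notation.** $\sigma_0$ denotes the volume of the unit sphere $S^n$. The LOC curve represents the LOC, the point $(r,\rho)$ representing the submanifold $\{(rx,\rho f(x)): x\in S^n\}$ of $\mathbb R^{m+n+2}$. *)

theory Defs
  imports "HOL-Analysis.Analysis"
begin

section \<open>Smooth maps and embedded submanifolds of Euclidean spaces\<close>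

text \<open>
  Only used for open \<open>U\<close>: by finite-dimensionality it suffices that all iterated directional
  derivatives exist as functions differentiable on \<open>U\<close>.
\<close>

primrec Ck_on ::
    "nat \<Rightarrow> 'a::euclidean_space set \<Rightarrow> ('a \<Rightarrow> 'b::euclidean_space) \<Rightarrow> bool" where
  "Ck_on 0 U F \<longleftrightarrow> continuous_on U F"
| "Ck_on (Suc k) U F \<longleftrightarrow> (\<forall>x\<in>U. F differentiable (at x)) \<and>
     (\<forall>v. Ck_on k U (\<lambda>x. frechet_derivative F (at x) v))"

definition smooth_on_open :: "'a::euclidean_space set \<Rightarrow> ('a \<Rightarrow> 'b::euclidean_space) \<Rightarrow> bool" where
  "smooth_on_open U F \<longleftrightarrow> open U \<and> (\<forall>k. Ck_on k U F)"

text \<open>Smoothness on an arbitrary subset means: locally the restriction of a smooth map.\<close>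

definition smooth_map_on :: "'a::euclidean_space set \<Rightarrow> ('a \<Rightarrow> 'b::euclidean_space) \<Rightarrow> bool" where
  "smooth_map_on X f \<longleftrightarrow>
     (\<forall>x\<in>X. \<exists>U F. x \<in> U \<and> smooth_on_open U F \<and> (\<forall>y\<in>X \<inter> U. F y = f y))"

text \<open>Embedded submanifolds of dimension \<open>d\<close>, through slice charts.\<close>

definition embedded_submanifold :: "nat \<Rightarrow> 'e::euclidean_space set \<Rightarrow> bool" where
  "embedded_submanifold d M \<longleftrightarrow>
     (\<forall>p\<in>M. \<exists>U V (\<phi>::'e \<Rightarrow> 'e) (\<psi>::'e \<Rightarrow> 'e) L. p \<in> U \<and>
        smooth_on_open U \<phi> \<and> smooth_on_open V \<psi> \<and> homeomorphism U V \<phi> \<psi> \<and>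
        subspace L \<and> dim L = d \<and> \<phi> ` (M \<inter> U) = L \<inter> V)"

section \<open>Minimal submanifolds of the unit sphere\<close>

definition curve_through :: "'e::euclidean_space set \<Rightarrow> 'e \<Rightarrow> (real \<Rightarrow> 'e) \<Rightarrow> bool" where
  "curve_through M p \<gamma> \<longleftrightarrow>
     (\<exists>\<epsilon>>0. smooth_on_open {-\<epsilon><..<\<epsilon>} \<gamma> \<and> \<gamma> ` {-\<epsilon><..<\<epsilon>} \<subseteq> M) \<and> \<gamma> 0 = p"

abbreviation velocity :: "(real \<Rightarrow> 'e::euclidean_space) \<Rightarrow> real \<Rightarrow> 'e" where
  "velocity \<gamma> t \<equiv> vector_derivative \<gamma> (at t)"

abbreviation acceleration :: "(real \<Rightarrow> 'e::euclidean_space) \<Rightarrow> real \<Rightarrow> 'e" where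
  "acceleration \<gamma> t \<equiv> vector_derivative (velocity \<gamma>) (at t)"

definition tangent_space_of :: "'e::euclidean_space set \<Rightarrow> 'e \<Rightarrow> 'e set" where
  "tangent_space_of M p = {velocity \<gamma> 0 | \<gamma>. curve_through M p \<gamma>}"

text \<open>
  For \<open>M \<subseteq> sphere 0 1\<close>: the normal space of \<open>M\<close> inside the tangent space of the sphere
  at \<open>p\<close>, which is the orthogonal complement of \<open>p\<close>.
\<close>

definition sphere_normal_space :: "'e::euclidean_space set \<Rightarrow> 'e \<Rightarrow> 'e set" where
  "sphere_normal_space M p = {\<nu>. \<nu> \<bullet> p = 0 \<and> (\<forall>v\<in>tangent_space_of M p. \<nu> \<bullet> v = 0)}"

text \<open>
  The second fundamental form \<open>II(v,v)\<close> of \<open>M\<close> in the unit sphere: the sphere-normal component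
  of the acceleration of any curve in \<open>M\<close> with velocity \<open>v\<close> (it depends on \<open>v\<close> only).
\<close>

definition second_fundamental_form :: "'e::euclidean_space set \<Rightarrow> 'e \<Rightarrow> 'e \<Rightarrow> 'e" where
  "second_fundamental_form M p v =
     (THE w. w \<in> sphere_normal_space M p \<and>
        (\<exists>\<gamma>. curve_through M p \<gamma> \<and> velocity \<gamma> 0 = v \<and>
           (\<forall>\<nu>\<in>sphere_normal_space M p. (acceleration \<gamma> 0 - w) \<bullet> \<nu> = 0)))"

definition orthonormal_basis_of :: "'e::euclidean_space set \<Rightarrow> 'e set \<Rightarrow> bool" where
  "orthonormal_basis_of T B \<longleftrightarrow>
     B \<subseteq> T \<and> span B = T \<and> pairwise orthogonal B \<and> (\<forall>v\<in>B. norm v = 1)"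

definition minimal_submanifold_of_sphere :: "nat \<Rightarrow> 'e::euclidean_space set \<Rightarrow> bool" where
  "minimal_submanifold_of_sphere d M \<longleftrightarrow>
     M \<subseteq> sphere 0 1 \<and> embedded_submanifold d M \<and>
     (\<forall>p\<in>M. \<forall>B. orthonormal_basis_of (tangent_space_of M p) B \<longrightarrow>
        (\<Sum>v\<in>B. second_fundamental_form M p v) = 0)"

section \<open>Lawson--Osserman maps\<close>

text \<open>
  The sphere \<open>S^n\<close> is \<open>sphere (0::'a) 1\<close> with \<open>DIM('a) = n + 1\<close>, and
  \<open>M_{f,\<theta>}\<close> lies in the unit sphere of \<open>'a \<times> 'b\<close>.
  Values of \<open>f\<close> off the unit sphere are irrelevant throughout.
\<close>

definition LO_submanifold ::
    "('a::euclidean_space \<Rightarrow> 'b::euclidean_space) \<Rightarrow> real \<Rightarrow> ('a \<times> 'b) set" where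
  "LO_submanifold f \<theta> = (\<lambda>x. (cos \<theta> *\<^sub>R x, sin \<theta> *\<^sub>R f x)) ` sphere 0 1"

definition LOM_angle :: "('a::euclidean_space \<Rightarrow> 'b::euclidean_space) \<Rightarrow> real \<Rightarrow> bool" where
  "LOM_angle f \<theta> \<longleftrightarrow> 0 < \<theta> \<and> \<theta> < pi / 2 \<and>
     minimal_submanifold_of_sphere (DIM('a) - 1) (LO_submanifold f \<theta>)"

definition LOM :: "('a::euclidean_space \<Rightarrow> 'b::euclidean_space) \<Rightarrow> bool" where
  "LOM f \<longleftrightarrow> f ` sphere 0 1 \<subseteq> sphere 0 1 \<and> smooth_map_on (sphere 0 1) f \<and> (\<exists>\<theta>. LOM_angle f \<theta>)"

text \<open>
  The differential of a map on the sphere is that of its degree-zero homogeneous extension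
  (recall \<open>sgn y = y /\<^sub>R norm y\<close>), restricted to the tangent space of the sphere.
\<close>

definition sphere_differential ::
    "('a::euclidean_space \<Rightarrow> 'b::euclidean_space) \<Rightarrow> 'a \<Rightarrow> 'a \<Rightarrow> 'b" where
  "sphere_differential f x = frechet_derivative (\<lambda>y. f (sgn y)) (at x)"

text \<open>
  The \<open>s\<^sup>2\<close>-eigenspace of \<open>A\<^sup>* A\<close> on the tangent space at \<open>x\<close>, where \<open>A\<close> is the differential;
  the equation \<open>A\<^sup>* A v = s\<^sup>2 v\<close> is tested against tangent vectors \<open>w\<close>.
\<close>

definition singular_space ::
    "('a::euclidean_space \<Rightarrow> 'b::euclidean_space) \<Rightarrow> 'a \<Rightarrow> real \<Rightarrow> 'a set" where
  "singular_space f x s = {v. v \<bullet> x = 0 \<and> (\<forall>w. w \<bullet> x = 0 \<longrightarrow>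
     sphere_differential f x v \<bullet> sphere_differential f x w = s\<^sup>2 * (v \<bullet> w))}"

definition singular_values ::
    "('a::euclidean_space \<Rightarrow> 'b::euclidean_space) \<Rightarrow> 'a \<Rightarrow> real set" where
  "singular_values f x = {s. 0 \<le> s \<and> (\<exists>v\<in>singular_space f x s. v \<noteq> 0)}"

definition LOMSE :: "('a::euclidean_space \<Rightarrow> 'b::euclidean_space) \<Rightarrow> bool" where
  "LOMSE f \<longleftrightarrow> LOM f \<and> (\<forall>x\<in>sphere 0 1. \<exists>lam>0. singular_values f x = {0, lam})"

text \<open>
  \<open>lam\<close> is the nonzero singular value of \<open>f\<close> and \<open>p\<close> its multiplicity. For an LOMSE
  neither depends on the point, so they are read off at one point of the sphere, without
  building their constancy into the definition.
\<close>

definition LOMSE_singular_value ::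
    "('a::euclidean_space \<Rightarrow> 'b::euclidean_space) \<Rightarrow> real \<Rightarrow> nat \<Rightarrow> bool" where
  "LOMSE_singular_value f lam p \<longleftrightarrow> LOMSE f \<and> 0 < lam \<and>
     (\<exists>x\<in>sphere 0 1. singular_values f x = {0, lam} \<and> dim (singular_space f x lam) = p)"

section \<open>Spherical harmonics and the type of an LOMSE\<close>

definition laplacian :: "('a::euclidean_space \<Rightarrow> real) \<Rightarrow> 'a \<Rightarrow> real" where
  "laplacian P x =
     (\<Sum>b\<in>Basis. frechet_derivative (\<lambda>y. frechet_derivative P (at y) b) (at x) b)"

definition spherical_harmonic :: "nat \<Rightarrow> ('a::euclidean_space \<Rightarrow> real) \<Rightarrow> bool" where
  "spherical_harmonic k Y \<longleftrightarrow>
     (\<exists>P. real_polynomial_function P \<and> (\<forall>t x. P (t *\<^sub>R x) = t ^ k * P x) \<and>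
        (\<forall>x. laplacian P x = 0) \<and> (\<forall>x\<in>sphere 0 1. Y x = P x))"

definition LOMSE_of_type ::
    "('a::euclidean_space \<Rightarrow> 'b::euclidean_space) \<Rightarrow> nat \<Rightarrow> nat \<Rightarrow> nat \<Rightarrow> bool" where
  "LOMSE_of_type f n p k \<longleftrightarrow>
     DIM('a) = n + 1 \<and> (\<exists>lam. LOMSE_singular_value f lam p) \<and>
     even k \<and> (\<forall>b\<in>Basis. spherical_harmonic k (\<lambda>x. f x \<bullet> b))"

definition LOMSE_type_I ::
    "('a::euclidean_space \<Rightarrow> 'b::euclidean_space) \<Rightarrow> nat \<Rightarrow> nat \<Rightarrow> bool" where
  "LOMSE_type_I f n p \<longleftrightarrow>
     (\<exists>k. LOMSE_of_type f n p k \<and> (n, p, k) \<in> {(3, 2, 2), (5, 4, 2), (5, 4, 4)}) \<or> n \<ge> 7"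

section \<open>The canonical metric and lengths of curves\<close>

text \<open>
  Surface measure on the unit sphere in polar coordinates: \<open>DIM('a)\<close> times the Lebesgue measure
  of the solid cone over \<open>A\<close> with apex \<open>0\<close>.
\<close>

definition sphere_measure :: "'a::euclidean_space set \<Rightarrow> real" where
  "sphere_measure A = real DIM('a) * measure lebesgue {t *\<^sub>R x | t x. 0 < t \<and> t \<le> 1 \<and> x \<in> A}"

definition canonical_metric ::
    "real \<Rightarrow> real \<Rightarrow> nat \<Rightarrow> nat \<Rightarrow> real \<times> real \<Rightarrow> real \<times> real \<Rightarrow> real \<times> real \<Rightarrow> real" where
  "canonical_metric \<sigma>\<^sub>0 lam n p = (\<lambda>(r, \<rho>) u v.
     \<sigma>\<^sub>0\<^sup>2 * (r\<^sup>2 + lam\<^sup>2 * \<rho>\<^sup>2) ^ p * r ^ (2 * (n - p)) * (u \<bullet> v))"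

text \<open>
  Extended-real valued, since the library's piecewise \<open>C\<^sup>1\<close> paths may have infinite length
  (their derivative may blow up at finitely many parameters).
\<close>

definition riemannian_length ::
    "(real \<times> real \<Rightarrow> real \<times> real \<Rightarrow> real \<times> real \<Rightarrow> real) \<Rightarrow> (real \<Rightarrow> real \<times> real) \<Rightarrow> ennreal" where
  "riemannian_length g \<gamma> =
     (\<integral>\<^sup>+t\<in>{0..1}. ennreal (sqrt (g (\<gamma> t) (velocity \<gamma> t) (velocity \<gamma> t))) \<partial>lborel)"

definition LOC_curve :: "real \<Rightarrow> (real \<times> real) set" where
  "LOC_curve \<theta> = {(r, \<rho>). r > 0 \<and> \<rho> = tan \<theta> * r}"

definition angular_region :: "real \<Rightarrow> (real \<times> real) set" where
  "angular_region c = {(r, \<rho>). r > 0 \<and> 0 < \<rho> \<and> \<rho> < c * r}"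

text \<open>For a ray \<open>C\<close>; its part between two points is the segment joining them.\<close>

definition ray_length_minimizing_in ::
    "(real \<times> real \<Rightarrow> real \<times> real \<Rightarrow> real \<times> real \<Rightarrow> real) \<Rightarrow> (real \<times> real) set \<Rightarrow> (real \<times> real) set \<Rightarrow> bool"
  where
  "ray_length_minimizing_in g C R \<longleftrightarrow>
     (\<forall>P\<in>C. \<forall>Q\<in>C. \<forall>\<gamma>. valid_path \<gamma> \<and> path_image \<gamma> \<subseteq> R \<and> pathstart \<gamma> = P \<and> pathfinish \<gamma> = Q \<longrightarrow>
        riemannian_length g (linepath P Q) \<le> riemannian_length g \<gamma>)"

end

theory Submission
  imports Defs
begin

text \<open>
  The ray is calibrated: with \<open>A = r\<^sup>2 + lam\<^sup>2 \<rho>\<^sup>2\<close>, \<open>N = r\<^sup>2 + \<rho>\<^sup>2\<close>, \<open>q = n - p\<close>, let \<open>E\<close> be the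
  degree-zero function \<open>A^p r^(2q) / N^n\<close>, which is maximal on the LOC curve, normalised to be \<open>1\<close>
  there. The function \<open>G\<close> proportional to \<open>N^((n+1)/2) E^s\<close> has \<open>g\<^sub>0\<close>-gradient of length at most
  \<open>1\<close>, with equality on the ray, provided that
  \<open>E^(2s-1) (1 + 4 s\<^sup>2 n\<^sup>2/(n+1)\<^sup>2 z\<^sup>2 (p+z-b) / ((p+z)\<^sup>2 (q-z))) \<le> 1\<close>, where \<open>b = n/lam\<^sup>2\<close> and
  \<open>z = nA/(lam\<^sup>2 N) - p\<close> is the angular coordinate in which \<open>E = (1+z/p)^p (1-z/q)^q\<close> and the ray
  is \<open>z = 0\<close>. Then \<open>G\<close> bounds from below the length of every competitor. For \<open>n \<ge> 7\<close> the exponent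
  \<open>s = 6/5\<close> works for all \<open>p\<close> and \<open>lam\<close>, because \<open>b = 0\<close> is the worst case; in the three remaining
  cases \<open>s = 1\<close> works for small \<open>z\<close>, once \<open>lam\<close> is known.

  The needed relation between \<open>\<theta>\<close>, \<open>n\<close>, \<open>p\<close> and \<open>lam\<close> is the component of the mean curvature of
  \<open>M_{f,\<theta>}\<close> along \<open>(- sin \<theta> x, cos \<theta> f(x))\<close>, and \<open>p lam\<^sup>2 = k (k + n - 1)\<close> follows by applying
  the Laplacian to \<open>|f|\<^sup>2 = 1\<close>; both only involve one point of the sphere.
\<close>

section \<open>Inequalities for the calibration\<close>

text \<open>
  Up to a positive factor, the quadratic is the derivative at \<open>z = -w\<close> of the logarithm of the left
  side of the calibration inequality with \<open>b = 0\<close>; here \<open>7/5 = 2s - 1\<close> and \<open>144/25 = 4s\<^sup>2\<close> for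
  \<open>s = 6/5\<close>. The exponent \<open>s = 1\<close> would fail for \<open>n = 7\<close>, \<open>p = 1\<close>.
\<close>

lemma calibration_quadratic_nonneg:
  fixes p q :: nat and n T K w :: real
  assumes "1 \<le> p" "1 \<le> q" "7 \<le> p + q"
    and n: "n = real p + real q" and T: "T = 7 * n / 5" and K: "K = 144 / 25 * n\<^sup>2 / (n + 1)\<^sup>2"
    and w: "0 \<le> w" "w \<le> p"
  shows "0 \<le> real p * real q * (T - 2 * K) - (real q - real p) * (T - K) * w + T * (K - 1) * w\<^sup>2"
proof -
  \<comment> \<open>\<open>M\<close> is \<open>T / K\<close>. Dividing the claim by
    \<open>p * q * K\<close> and setting \<open>x = w / p\<close>, \<open>r = p / q\<close> turns
    its right side into
    \<open>M * (1 - x) * (1 + r * x) + T * r * x^2 - 2 + (1 - r) * x\<close>.\<close>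
  define M where "M = 35 / 144 * (n + 1)\<^sup>2 / n"
  define x r where "x = w / p" and "r = real p / q"
  have pq: "real p \<ge> 1" "real q \<ge> 1" using assms by auto
  have n7: "n \<ge> 7" using assms by linarith
  have K0: "K > 0" using n7 by (simp add: K)
  have TMK: "T = M * K" using n7 by (simp add: T M_def K divide_simps power2_eq_square)
  have x: "0 \<le> x" "x \<le> 1" "w = p * x" using w pq by (auto simp: x_def)
  have r: "r > 0" "real p = r * q" using pq by (auto simp: r_def)
  have Tr: "T * r = 7 / 5 * p * (1 + r)" using pq by (simp add: T n r_def field_simps)
  \<comment> \<open>Since \<open>p \<ge> 1\<close>, the factor \<open>T * r\<close> is at least
    \<open>7/5 * (1 + r)\<close>. With this replacement the expression becomes
    \<open>f0 + r * f1\<close>, where \<open>f0\<close> and \<open>f1\<close> are free of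
    \<open>r\<close>.\<close>
  define f0 f1 where "f0 = M * (1 - x) + 7/5 * x\<^sup>2 - 2 + x" and "f1 = M * x * (1 - x) + 7/5 * x\<^sup>2 - x"
  have M1: "M \<ge> 20 / 9"
  proof -
    have "0 \<le> (n - 7) * (7 * n - 1)" using n7 by simp
    then show ?thesis using n7 by (simp add: M_def field_simps power2_eq_square)
  qed
  have f1: "f1 \<ge> 0"
  proof -
    have "f1 = x * ((M - 1) * (1 - x) + 2/5 * x)" by (simp add: f1_def algebra_simps power2_eq_square)
    then show ?thesis using M1 x by simp
  qed
  \<comment> \<open>For \<open>n = 7\<close> the term \<open>f0\<close> takes negative values, and a
    share of \<open>r * f1\<close> has to compensate; \<open>q \<le> 6\<close> gives
    \<open>r \<ge> 1/6\<close>. From \<open>n = 8\<close> on, \<open>M \<ge> 49/20\<close> makes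
    \<open>f0\<close> nonnegative by itself.\<close>
  have "0 \<le> f0 + r * f1"
  proof (cases "p + q = 7")
    case True
    then have "q \<le> 6" using assms by linarith
    then have "real q \<le> 6" by linarith
    then have r6: "r \<ge> 1/6" using pq unfolding r_def by (simp add: field_simps)
    have "n = 7" using True n by linarith
    then have M: "M = 20/9" by (simp add: M_def)
    have "r * f1 \<ge> 1/6 * f1" using r6 f1 by (rule mult_right_mono)
    moreover have "f0 + 1/6 * f1 = 341/270 * (x - 275/682)\<^sup>2 + 2/9 - 341/270 * (275/682)\<^sup>2"
      by (simp add: f0_def f1_def M power2_eq_square field_simps)
    moreover have "(2/9::real) - 341/270 * (275/682)\<^sup>2 \<ge> 0" by (simp add: power2_eq_square)
    moreover have "341/270 * (x - 275/682)\<^sup>2 \<ge> 0" by simp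
    ultimately show ?thesis by linarith
  next
    case False
    then have "8 \<le> p + q" using assms by linarith
    then have n8: "n \<ge> 8" using n by linarith
    have "0 \<le> (n - 8) * (8 * n - 1)" using n8 by simp
    then have "M \<ge> 35 * 81 / (144 * 8)" using n8 by (simp add: M_def field_simps power2_eq_square)
    then have "M \<ge> 49/20" by simp
    then have "M * (1 - x) \<ge> 49/20 * (1 - x)" using x by (intro mult_right_mono) auto
    moreover have "49/20 * (1 - x) + 7/5 * x\<^sup>2 - 2 + x
        = 7/5 * (x - 29/56)\<^sup>2 + 9/20 - 7/5 * (29/56)\<^sup>2" by (simp add: power2_eq_square field_simps)
    moreover have "(9/20::real) - 7/5 * (29/56)\<^sup>2 \<ge> 0" by (simp add: power2_eq_square)
    moreover have "7/5 * (x - 29/56)\<^sup>2 \<ge> 0" by simp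
    ultimately have "f0 \<ge> 0" unfolding f0_def by linarith
    then show ?thesis using f1 r by simp
  qed
  moreover have "7/5 * (1 + r) * x\<^sup>2 \<le> T * r * x\<^sup>2"
    unfolding Tr using pq r by (intro mult_right_mono) auto
  ultimately have "0 \<le> M * (1 - x) * (1 + r * x) + T * r * x\<^sup>2 - 2 + (1 - r) * x"
    by (simp add: f0_def f1_def algebra_simps power2_eq_square)
  then have "0 \<le> real p * real q * K * (M * (1 - x) * (1 + r * x) + T * r * x\<^sup>2 - 2 + (1 - r) * x)"
    using K0 by simp
  also have "\<dots> = real p * real q * (T - 2 * K) - (real q - real p) * (T - K) * w + T * (K - 1) * w\<^sup>2"
  proof -
    have "P * Q * K * (M * (1 - x) * (1 + r * x) + M * K * r * x\<^sup>2 - 2 + (1 - r) * x)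
        = P * Q * (M * K - 2 * K) - (Q - P) * (M * K - K) * (P * x) + M * K * (K - 1) * (P * x)\<^sup>2"
      if "P = r * Q" for P Q :: real
      unfolding that by (simp add: algebra_simps power2_eq_square)
    from this[OF r(2)] show ?thesis unfolding TMK x(3) .
  qed
  finally show ?thesis .
qed

text \<open>The left side decreases in \<open>b\<close>, so it is enough to treat
  \<open>b = 0\<close>. There its logarithm has as derivative \<open>- z\<close> times a nonnegative
  function, by the preceding quadratic estimate, and so is maximal at \<open>z = 0\<close>, with
  value 0.\<close>

lemma calibration_inequality_large:
  fixes p q :: nat and z b n :: real
  assumes pq: "1 \<le> p" "1 \<le> q" "7 \<le> p + q"
    and n: "n = real p + real q"
    and z: "- real p < z" "z < q" and b: "0 \<le> b"
  shows "exp (7 / 5 * (p * ln (1 + z / p) + q * ln (1 - z / q))) *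
      (1 + (6/5)\<^sup>2 * (4 * n\<^sup>2 / (n + 1)\<^sup>2) * z\<^sup>2 * (p + z - b) / ((p + z)\<^sup>2 * (q - z))) \<le> 1"
proof -
  define K where "K = 144 / 25 * n\<^sup>2 / (n + 1)\<^sup>2"
  define T where "T = 7 * n / 5"
  have n7: "n \<ge> 7" using pq n by linarith
  have p0: "real p > 0" "real q > 0" using pq by auto
  have K0: "K \<ge> 0" by (simp add: K_def)
  \<comment> \<open>Logarithm of the left side at \<open>b = 0\<close>. The second factor is then
    \<open>D z / ((p + z) * (q - z))\<close>, because \<open>K = 4 s^2 n^2 / (n + 1)^2\<close> for
    \<open>s = 6/5\<close>.\<close>
  define \<Psi> where "\<Psi> z = 7 / 5 * (p * ln (1 + z / p) + q * ln (1 - z / q))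
      + ln ((p + z) * (q - z) + K * z\<^sup>2) - ln ((p + z) * (q - z))" for z :: real
  define D where "D z = (p + z) * (q - z) + K * z\<^sup>2" for z :: real
  define Qt where "Qt z = real p * real q * (T - 2 * K) + (real q - real p) * (T - K) * z + T * (K - 1) * z\<^sup>2" for z :: real
  \<comment> \<open>The estimate with \<open>w = - z\<close> covers \<open>z \<le> 0\<close>;
    exchanging \<open>p\<close> and \<open>q\<close> and taking \<open>w = z\<close> covers
    \<open>z > 0\<close>.\<close>
  have Qt: "Qt z \<ge> 0" if "- real p < z" "z < q" for z :: real
  proof (cases "z \<le> 0")
    case True
    then show ?thesis
      using calibration_quadratic_nonneg[OF pq n T_def K_def, of "- z"] that by (simp add: Qt_def)
  next
    case False
    then have "0 \<le> real q * real p * (T - 2 * K) - (real p - real q) * (T - K) * z + T * (K - 1) * z\<^sup>2"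
      using pq that by (intro calibration_quadratic_nonneg[OF _ _ _ _ T_def K_def]) (auto simp: n)
    then show ?thesis by (simp add: Qt_def algebra_simps)
  qed
  have der: "(\<Psi> has_real_derivative - z * Qt z / ((p + z) * (q - z) * D z)) (at z)"
    if z: "- real p < z" "z < q" for z :: real
  proof -
    have pos: "p + z > 0" "q - z > 0" using z by auto
    then have prod: "(p + z) * (q - z) > 0" by simp
    have D0: "D z > 0" unfolding D_def using prod K0 by (simp add: add_pos_nonneg)
    have pos': "1 + z / p > 0" "1 - z / q > 0" using pos p0 by (simp_all add: field_simps)
    have D0': "(p + z) * (q - z) + K * z\<^sup>2 > 0" using D0 by (simp add: D_def)
    have "(\<Psi> has_real_derivative
       7 / 5 * (p * ((1 / p) / (1 + z / p)) + q * ((- 1 / q) / (1 - z / q)))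
       + ((q - z) - (p + z) + K * (2 * z)) / D z - ((q - z) - (p + z)) / ((p + z) * (q - z))) (at z)"
    proof -
      have d1: "((\<lambda>z. ln (1 + z / p)) has_real_derivative (1 / p) / (1 + z / p)) (at z)"
        using pos' p0 by (auto intro!: derivative_eq_intros)
      have d2: "((\<lambda>z. ln (1 - z / q)) has_real_derivative (- 1 / q) / (1 - z / q)) (at z)"
        using pos' p0 by (auto intro!: derivative_eq_intros)
      have d3: "((\<lambda>z. ln ((p + z) * (q - z) + K * z\<^sup>2)) has_real_derivative
          ((q - z) - (p + z) + K * (2 * z)) / D z) (at z)"
        using D0' by (auto intro!: derivative_eq_intros simp: D_def)
      have d4: "((\<lambda>z. ln ((p + z) * (q - z))) has_real_derivative
          ((q - z) - (p + z)) / ((p + z) * (q - z))) (at z)"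
        using prod by (auto intro!: derivative_eq_intros)
      show ?thesis unfolding \<Psi>_def
        by (rule DERIV_diff[OF DERIV_add[OF DERIV_cmult[OF DERIV_add[OF DERIV_cmult[OF d1] DERIV_cmult[OF d2]]] d3] d4])
    qed
    also have "p * ((1 / p) / (1 + z / p)) + q * ((- 1 / q) / (1 - z / q)) = p / (p + z) - q / (q - z)"
      using p0 pos by (simp add: field_simps)
    also have "7 / 5 * (p / (p + z) - q / (q - z)) + ((q - z) - (p + z) + K * (2 * z)) / D z
        - ((q - z) - (p + z)) / ((p + z) * (q - z)) = - z * Qt z / ((p + z) * (q - z) * D z)"
    proof -
      \<comment> \<open>The fractions are combined with \<open>d\<close> as an opaque nonzero
        number; its formula enters only in the identity for the numerator.\<close>
      have frac: "7 / 5 * (P / u - Q / v) + N1 / d - N2 / (u * v)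
          = (7 / 5 * (P * v - Q * u) * d + N1 * (u * v) - N2 * d) / (u * v * d)"
        if "u \<noteq> 0" "v \<noteq> 0" "d \<noteq> 0" for P Q u v d N1 N2 :: real
        using that by (simp add: add_divide_distrib diff_divide_distrib right_diff_distrib left_diff_distrib)
      have gen: "7 / 5 * (P / (P + z) - Q / (Q - z)) + ((Q - z) - (P + z) + K * (2 * z)) / d
        - ((Q - z) - (P + z)) / ((P + z) * (Q - z)) = - z * (P * Q * (T - 2 * K) + (Q - P) * (T - K) * z
          + T * (K - 1) * z\<^sup>2) / ((P + z) * (Q - z) * d)"
        if "P + z \<noteq> 0" "Q - z \<noteq> 0" "d \<noteq> 0" "d = (P + z) * (Q - z) + K * z\<^sup>2" "T = 7 * (P + Q) / 5" for P Q d
      proof -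
        have "7 / 5 * (P / (P + z) - Q / (Q - z)) + ((Q - z) - (P + z) + K * (2 * z)) / d
           - ((Q - z) - (P + z)) / ((P + z) * (Q - z)) =
          (7 / 5 * (P * (Q - z) - Q * (P + z)) * d + ((Q - z) - (P + z) + K * (2 * z)) * ((P + z) * (Q - z))
            - ((Q - z) - (P + z)) * d) / ((P + z) * (Q - z) * d)"
          using frac[OF that(1-3)] .
        also have "7 / 5 * (P * (Q - z) - Q * (P + z)) * d + ((Q - z) - (P + z) + K * (2 * z)) * ((P + z) * (Q - z))
            - ((Q - z) - (P + z)) * d = - z * (P * Q * (T - 2 * K) + (Q - P) * (T - K) * z + T * (K - 1) * z\<^sup>2)"
          unfolding that(4,5) by (simp add: field_simps power2_eq_square)
        finally show ?thesis .
      qed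
      show ?thesis unfolding Qt_def
        using gen[of p q "D z"] pos D0 by (simp add: D_def T_def n)
    qed
    finally show ?thesis .
  qed
  have DD: "D z > 0" if "- real p < z" "z < q" for z :: real
    unfolding D_def using that K0 by (simp add: add_pos_nonneg)
  have "\<Psi> z \<le> \<Psi> 0"
  proof (cases "z \<le> 0")
    case True
    show ?thesis
    proof (rule DERIV_nonneg_imp_nondecreasing[OF True])
      fix x assume x: "z \<le> x" "x \<le> 0"
      then have "- real p < x" "x < q" using z p0 by auto
      then show "\<exists>y. (\<Psi> has_real_derivative y) (at x) \<and> 0 \<le> y"
        using der[of x] Qt[of x] DD[of x] x
        by (intro exI[of _ "- x * Qt x / ((p + x) * (q - x) * D x)"] conjI divide_nonneg_nonneg mult_nonneg_nonneg) auto
    qed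
  next
    case False
    then have z0: "0 \<le> z" by simp
    show ?thesis
    proof (rule DERIV_nonpos_imp_nonincreasing[OF z0])
      fix x assume x: "0 \<le> x" "x \<le> z"
      then have "- real p < x" "x < q" using z p0 by auto
      then show "\<exists>y. (\<Psi> has_real_derivative y) (at x) \<and> y \<le> 0"
        using der[of x] Qt[of x] DD[of x] x
        by (intro exI[of _ "- x * Qt x / ((p + x) * (q - x) * D x)"] conjI divide_nonpos_nonneg mult_nonneg_nonneg)
           (auto simp: mult_nonpos_nonneg)
    qed
  qed
  also have "\<Psi> 0 = 0" using p0 by (simp add: \<Psi>_def)
  finally have \<Psi>0: "\<Psi> z \<le> 0" .
  have prod: "(p + z) * (q - z) > 0" using z by simp
  have "exp (\<Psi> z) = exp (7 / 5 * (p * ln (1 + z / p) + q * ln (1 - z / q))) * (D z / ((p + z) * (q - z)))"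
    using prod DD[OF z] unfolding \<Psi>_def D_def by (simp add: exp_diff exp_add)
  also have "D z / ((p + z) * (q - z)) = 1 + K * z\<^sup>2 / ((p + z) * (q - z))"
    using prod z by (simp add: D_def add_divide_distrib)
  finally have *: "exp (7 / 5 * (p * ln (1 + z / p) + q * ln (1 - z / q))) *
      (1 + K * z\<^sup>2 / ((p + z) * (q - z))) \<le> 1" using \<Psi>0 by (metis exp_le_one_iff)
  have "(p + z - b) / ((p + z)\<^sup>2 * (q - z)) \<le> (p + z) / ((p + z)\<^sup>2 * (q - z))"
    using z b by (intro divide_right_mono) auto
  also have "\<dots> = 1 / ((p + z) * (q - z))" using z by (simp add: power2_eq_square)
  finally have "K * z\<^sup>2 * ((p + z - b) / ((p + z)\<^sup>2 * (q - z))) \<le> K * z\<^sup>2 * (1 / ((p + z) * (q - z)))"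
    using K0 by (intro mult_left_mono) auto
  then have "exp (7 / 5 * (p * ln (1 + z / p) + q * ln (1 - z / q))) *
      (1 + K * z\<^sup>2 * ((p + z - b) / ((p + z)\<^sup>2 * (q - z))))
     \<le> exp (7 / 5 * (p * ln (1 + z / p) + q * ln (1 - z / q))) * (1 + K * z\<^sup>2 / ((p + z) * (q - z)))"
    by (intro mult_left_mono) auto
  moreover have "(6/5)\<^sup>2 * (4 * n\<^sup>2 / (n + 1)\<^sup>2) = K" by (simp add: K_def power2_eq_square)
  ultimately show ?thesis using * by (simp only: times_divide_eq_right)
qed

text \<open>The exceptional types have \<open>q = 1\<close>. With \<open>s = 1\<close> the exponent
  \<open>2s - 1\<close> is 1 and the left side is a polynomial \<open>1 - z^2 h(z)\<close>, so it
  remains to see that \<open>h \<ge> 0\<close> for \<open>z \<le> 1/10\<close>. The range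
  \<open>5/8 \<le> b\<close> covers both types with \<open>p = 4\<close>.\<close>

lemma calibration_inequality_small:
  fixes p :: nat and z b n :: real
  assumes pb: "p = 2 \<and> b = 3/4 \<or> p = 4 \<and> 5/8 \<le> b"
    and n: "n = real p + 1" and z: "b - real p < z" "z \<le> 1/10" "- real p < z"
  shows "exp (p * ln (1 + z / p) + ln (1 - z)) *
      (1 + 4 * n\<^sup>2 / (n + 1)\<^sup>2 * z\<^sup>2 * (p + z - b) / ((p + z)\<^sup>2 * (1 - z))) \<le> 1"
proof -
  have p0: "real p > 0" using pb by auto
  have pos: "1 + z / p > 0" "1 - z > 0" "p + z > 0" using z p0 by (auto simp: field_simps)
  have e: "exp (p * ln (1 + z / p) + ln (1 - z)) = (1 + z / p) ^ p * (1 - z)"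
    using pos by (simp add: exp_add exp_of_nat_mult)
  show ?thesis using pb
  proof (elim disjE conjE)
    assume pb: "p = 2" "b = 3/4"
    have "(1 + z / 2) ^ 2 * (1 - z) * (1 + 9 / 4 * z\<^sup>2 * (2 + z - 3/4) / ((2 + z)\<^sup>2 * (1 - z)))
       = (1 + z / 2) ^ 2 * (1 - z) + 9/16 * z\<^sup>2 * (5/4 + z)"
      using pos pb by (simp add: divide_simps)
    also have "\<dots> = 1 - z\<^sup>2 * (3/64 - 5/16 * z)" by (simp add: field_simps power2_eq_square)
    also have "\<dots> \<le> 1" using z by simp
    finally show ?thesis unfolding e unfolding n pb by simp
  next
    assume pb: "p = 4" "5/8 \<le> b"
    have "(1 + z / 4) ^ 4 * (1 - z) * (1 + 25 / 9 * z\<^sup>2 * (4 + z - b) / ((4 + z)\<^sup>2 * (1 - z)))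
       = (1 + z / 4) ^ 4 * (1 - z) + 25/144 * z\<^sup>2 * (1 + z / 4) ^ 2 * (4 + z - b)"
    proof -
      have "(1 + z / 4) = (4 + z) / 4" by simp
      moreover have "((4 + z) / 4) ^ 4 * (1 - z) * (1 + 25 / 9 * z\<^sup>2 * (4 + z - b) / ((4 + z)\<^sup>2 * (1 - z)))
       = ((4 + z) / 4) ^ 4 * (1 - z) + 25/144 * z\<^sup>2 * ((4 + z) / 4) ^ 2 * (4 + z - b)"
      proof -
        have "y ^ 4 / 256 * w * (1 + c / (y\<^sup>2 * w)) = y ^ 4 / 256 * w + y\<^sup>2 / 256 * c"
          if "y \<noteq> 0" "w \<noteq> 0" for y w c :: real
          using that by (simp add: field_simps power2_eq_square power4_eq_xxxx)
        from this[of "4 + z" "1 - z" "25 / 9 * z\<^sup>2 * (4 + z - b)"] show ?thesis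
          using pos pb by (simp add: power_divide)
      qed
      ultimately show ?thesis by (simp only:)
    qed
    \<comment> \<open>The expression decreases in \<open>b\<close>, so the smallest admissible value
      5/8 is the worst.\<close>
    also have "\<dots> \<le> (1 + z / 4) ^ 4 * (1 - z) + 25/144 * z\<^sup>2 * (1 + z / 4) ^ 2 * (4 + z - 5/8)"
      using pb by (intro add_left_mono mult_left_mono) auto
    also have "\<dots> = 1 - z\<^sup>2 * (5/128 - 355/2304 * z - 1195/18432 * z\<^sup>2 - 1/144 * z ^ 3)"
      by (simp add: field_simps power2_eq_square power3_eq_cube power4_eq_xxxx)
    also have "\<dots> \<le> 1"
    proof -
      \<comment> \<open>For \<open>z \<le> 0\<close> the quadratic cofactor of
        \<open>- z / 144\<close> is positive because \<open>355/16 > (1195/256)^2\<close>; for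
        \<open>0 < z \<le> 1/10\<close> crude bounds on the powers of \<open>z\<close>
        suffice.\<close>
      have "0 \<le> 5/128 - 355/2304 * z - 1195/18432 * z\<^sup>2 - 1/144 * z ^ 3"
      proof (cases "z \<le> 0")
        case True
        have "5/128 - 355/2304 * z - 1195/18432 * z\<^sup>2 - 1/144 * z ^ 3
            = 5/128 - z / 144 * ((z + 1195/256)\<^sup>2 + (355/16 - (1195/256)\<^sup>2))"
          by (simp add: algebra_simps power2_eq_square power3_eq_cube)
        moreover have "z / 144 * ((z + 1195/256)\<^sup>2 + (355/16 - (1195/256)\<^sup>2)) \<le> 0"
          using True by (intro mult_nonpos_nonneg add_nonneg_nonneg) (auto simp: power2_eq_square)
        ultimately show ?thesis by simp
      next
        case False
        then have "z\<^sup>2 \<le> 1/100" "z ^ 3 \<le> 1/1000"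
          using z power_mono[of z "1/10" 2] power_mono[of z "1/10" 3] by (simp_all add: power_divide)
        then show ?thesis using z by simp
      qed
      then show ?thesis by simp
    qed
    finally show ?thesis unfolding e using pb n by simp
  qed
qed

section \<open>Calibrations\<close>

text \<open>The increment of \<open>G\<close> along the path is the integral of \<open>G'\<close>
  applied to the velocity, which the length density dominates. An infinite length leaves nothing to
  prove; a finite one makes the density integrable.\<close>

lemma length_ge_calibration:
  fixes G w :: "real \<times> real \<Rightarrow> real" and \<gamma> :: "real \<Rightarrow> real \<times> real"
  assumes \<gamma>: "valid_path \<gamma>" "path_image \<gamma> \<subseteq> R"
    and der: "\<And>x. x \<in> R \<Longrightarrow> (G has_derivative G' x) (at x)"
    and bound: "\<And>x v. x \<in> R \<Longrightarrow> G' x v \<le> w x * norm v"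
    and cont: "continuous_on R w" and nonneg: "\<And>x. x \<in> R \<Longrightarrow> 0 \<le> w x"
  shows "ennreal (G (pathfinish \<gamma>) - G (pathstart \<gamma>))
    \<le> (\<integral>\<^sup>+t\<in>{0..1}. ennreal (w (\<gamma> t) * norm (velocity \<gamma> t)) \<partial>lborel)"
proof -
  obtain S where S: "finite S" and c0: "continuous_on {0..1} \<gamma>" and C1: "\<gamma> C1_differentiable_on {0..1} - S"
    using \<gamma>(1) unfolding valid_path_def piecewise_C1_differentiable_on_def by blast
  have inR: "\<gamma> t \<in> R" if "t \<in> {0..1}" for t using \<gamma>(2) that unfolding path_image_def by blast
  have dif: "(\<gamma> has_vector_derivative velocity \<gamma> t) (at t)" if "t \<in> {0..1} - S" for t
    using C1 that unfolding C1_differentiable_on_eq by (simp add: vector_derivative_works)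
  have cv: "continuous_on ({0..1} - S) (velocity \<gamma>)" using C1 unfolding C1_differentiable_on_eq by blast
  \<comment> \<open>The length density, set to 0 at the finitely many parameters where the path may
    fail to be C1. It is Borel measurable, and its integral is at most the length.\<close>
  define \<phi> where "\<phi> t = indicator ({0..1} - S) t *\<^sub>R (w (\<gamma> t) * norm (velocity \<gamma> t))" for t
  have m: "\<phi> \<in> borel_measurable borel"
    unfolding \<phi>_def
  proof (rule borel_measurable_continuous_on_indicator)
    show "{0..1} - S \<in> sets borel" using S by (intro sets.Diff borel_closed) (auto simp: finite_imp_closed)
    have "continuous_on ({0..1} - S) (w \<circ> \<gamma>)"
      using inR by (intro continuous_on_compose continuous_on_subset[OF c0] continuous_on_subset[OF cont]) auto
    then show "continuous_on ({0..1} - S) (\<lambda>t. w (\<gamma> t) * norm (velocity \<gamma> t))"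
      using cv by (intro continuous_intros) (auto simp: o_def)
  qed
  have nn: "\<phi> t \<ge> 0" for t unfolding \<phi>_def using nonneg[OF inR] by (auto simp: indicator_def)
  have le: "(\<integral>\<^sup>+t. \<phi> t \<partial>lborel) \<le> (\<integral>\<^sup>+t\<in>{0..1}. ennreal (w (\<gamma> t) * norm (velocity \<gamma> t)) \<partial>lborel)"
    by (intro nn_integral_mono) (auto simp: \<phi>_def indicator_def)
  show ?thesis
  proof (cases "(\<integral>\<^sup>+t. \<phi> t \<partial>lborel) = \<infinity>")
    case True
    then show ?thesis using le by (simp add: top_unique)
  next
    case False
    then obtain r where r: "0 \<le> r" "(\<integral>\<^sup>+t. \<phi> t \<partial>lborel) = ennreal r"
      by (metis ennreal_cases infinity_ennreal_def)
    have "(\<phi> has_integral r) UNIV" using nn_integral_has_integral[OF m nn r(2,1)] .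
    also have "\<phi> = (\<lambda>t. if t \<in> {0..1} then \<phi> t else 0)" by (rule ext) (auto simp: \<phi>_def)
    finally have I1: "(\<phi> has_integral r) {0..1}" by (simp only: has_integral_restrict_UNIV)
    \<comment> \<open>The value 0 on \<open>S\<close> is arbitrary: for a continuous primitive the
      fundamental theorem of calculus tolerates a finite exceptional set and asks for no bound on
      the derivative.\<close>
    define f' where "f' t = (if t \<in> {0..1} - S then G' (\<gamma> t) (velocity \<gamma> t) else 0)" for t
    have "(f' has_integral (G \<circ> \<gamma>) 1 - (G \<circ> \<gamma>) 0) {0..1}"
    proof (rule fundamental_theorem_of_calculus_interior_strong[OF S])
      show "((G \<circ> \<gamma>) has_vector_derivative f' t) (at t)" if t: "t \<in> {0<..<1} - S" for t
      proof -
        have t': "t \<in> {0..1} - S" using t by auto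
        have "(G \<circ> \<gamma> has_derivative G' (\<gamma> t) \<circ> (\<lambda>h. h *\<^sub>R velocity \<gamma> t)) (at t)"
          using dif[OF t'] der[OF inR, of t] t' by (intro diff_chain_at) (auto simp: has_vector_derivative_def)
        moreover have "G' (\<gamma> t) \<circ> (\<lambda>h. h *\<^sub>R velocity \<gamma> t) = (\<lambda>h. h *\<^sub>R f' t)"
          using has_derivative_linear[OF der[OF inR, of t]] t' by (auto simp: f'_def linear_cmul)
        ultimately show ?thesis by (simp add: has_vector_derivative_def)
      qed
      show "continuous_on {0..1} (G \<circ> \<gamma>)"
      proof (intro continuous_on_compose c0 continuous_at_imp_continuous_on ballI)
        fix x assume "x \<in> \<gamma> ` {0..1}"
        then show "isCont G x" using inR der has_derivative_continuous by blast
      qed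
    qed simp
    then have "(G \<circ> \<gamma>) 1 - (G \<circ> \<gamma>) 0 \<le> r"
      by (rule has_integral_le[OF _ I1]) (use bound inR in \<open>auto simp: f'_def \<phi>_def\<close>)
    then have "ennreal (G (pathfinish \<gamma>) - G (pathstart \<gamma>)) \<le> ennreal r"
      by (intro ennreal_leI) (simp add: pathfinish_def pathstart_def)
    also have "\<dots> \<le> (\<integral>\<^sup>+t\<in>{0..1}. ennreal (w (\<gamma> t) * norm (velocity \<gamma> t)) \<partial>lborel)"
      using le r by simp
    finally show ?thesis .
  qed
qed

text \<open>The derivative of \<open>G\<close> never exceeds the length density and attains it in
  the direction of the ray. So the increment of \<open>G\<close> is the length of the segment and a
  lower bound for the length of every competitor. The two-sided bound serves both orientations of
  the segment.\<close>

lemma ray_length_minimizing_by_calibration: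
  fixes G w :: "real \<times> real \<Rightarrow> real" and \<tau> :: real
  assumes C: "C = {(r, \<rho>). r > 0 \<and> \<rho> = \<tau> * r}" "C \<subseteq> R"
    and g: "\<And>x v. x \<in> R \<Longrightarrow> sqrt (g x v v) = w x * norm v"
    and der: "\<And>x. x \<in> R \<Longrightarrow> (G has_derivative G' x) (at x)"
    and bound: "\<And>x v. x \<in> R \<Longrightarrow> \<bar>G' x v\<bar> \<le> w x * norm v"
    and cont: "continuous_on R w" and nonneg: "\<And>x. x \<in> R \<Longrightarrow> 0 \<le> w x"
    and calibrates: "\<And>r. r > 0 \<Longrightarrow> G' (r, \<tau> * r) (1, \<tau>) = w (r, \<tau> * r) * norm (1 :: real, \<tau>)"
  shows "ray_length_minimizing_in g C R"
  unfolding ray_length_minimizing_in_def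
proof (intro ballI allI impI)
  fix P Q \<gamma>
  assume P: "P \<in> C" and Q: "Q \<in> C"
    and "valid_path \<gamma> \<and> path_image \<gamma> \<subseteq> R \<and> pathstart \<gamma> = P \<and> pathfinish \<gamma> = Q"
  then have \<gamma>: "valid_path \<gamma>" "path_image \<gamma> \<subseteq> R" "pathstart \<gamma> = P" "pathfinish \<gamma> = Q" by auto
  obtain r1 r2 where r: "P = (r1, \<tau> * r1)" "Q = (r2, \<tau> * r2)" "r1 > 0" "r2 > 0" using P Q C by auto
  \<comment> \<open>If the segment runs towards the origin, \<open>- G\<close> takes the place of
    \<open>G\<close>.\<close>
  define e :: real where "e = (if r1 \<le> r2 then 1 else -1)"
  have e: "\<bar>e\<bar> = 1" "e * (r2 - r1) = \<bar>r2 - r1\<bar>" by (auto simp: e_def)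
  define L where "L = linepath P Q"
  define rr where "rr t = (1 - t) * r1 + t * r2" for t
  have L: "L t = (rr t, \<tau> * rr t)" for t by (simp add: L_def rr_def linepath_def r algebra_simps)
  have rr: "rr t > 0" if "t \<in> {0..1}" for t
    using convex_bound_lt[of "- r1" 0 "- r2" "1 - t" t] that r by (auto simp: rr_def)
  have LR: "L t \<in> R" if "t \<in> {0..1}" for t using C rr[OF that] by (auto simp: L)
  have QP: "Q - P = (r2 - r1) *\<^sub>R (1, \<tau>)" by (simp add: r algebra_simps)
  have path_L: "path_image L \<subseteq> R" using LR by (auto simp: path_image_def)
  have vel: "velocity L t = Q - P" for t unfolding L_def by (rule vector_derivative_linepath_at)
  have eq: "e * G' (L t) (Q - P) = w (L t) * norm (Q - P)" if t: "t \<in> {0..1}" for t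
  proof -
    have "G' (L t) (Q - P) = (r2 - r1) * (w (L t) * norm (1 :: real, \<tau>))"
      unfolding QP using has_derivative_linear[OF der[OF LR[OF t]]] calibrates[OF rr[OF t]]
      by (simp add: linear_cmul L del: scaleR_Pair)
    then have "e * G' (L t) (Q - P) = (e * (r2 - r1)) * (w (L t) * norm (1 :: real, \<tau>))" by simp
    then show ?thesis unfolding e QP by (simp del: scaleR_Pair)
  qed
  have "riemannian_length g L = (\<integral>\<^sup>+t. ennreal (w (L t) * norm (Q - P)) * indicator {0..1} t \<partial>lborel)"
    unfolding riemannian_length_def vel
    by (intro nn_integral_cong) (auto simp: g LR indicator_def)
  also have "\<dots> = (\<integral>\<^sup>+t. ennreal (indicator {0..1} t *\<^sub>R (w (L t) * norm (Q - P))) * indicator {0..1} t \<partial>lborel)"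
    by (intro nn_integral_cong) (auto simp: indicator_def)
  \<comment> \<open>By \<open>eq\<close> the length density of the segment is the derivative of
    \<open>e * G\<close> along it.\<close>
  also have "\<dots> = ennreal ((\<lambda>t. e * G (L t)) 1 - (\<lambda>t. e * G (L t)) 0)"
  proof (rule nn_integral_FTC_Icc)
    have "continuous_on {0..1} (w \<circ> L)" unfolding L_def
      by (intro continuous_on_compose continuous_on_subset[OF cont] continuous_on_linepath)
         (use LR in \<open>auto simp: L_def\<close>)
    then have "continuous_on {0..1} (\<lambda>t. w (L t) * norm (Q - P))" by (intro continuous_intros) (simp add: o_def)
    then show "(\<lambda>t. indicator {0..1} t *\<^sub>R (w (L t) * norm (Q - P))) \<in> borel_measurable borel"
      by (intro borel_measurable_continuous_on_indicator) auto
    fix t :: real assume t: "t \<in> {0..1}"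
    have "(L has_derivative (\<lambda>h. h *\<^sub>R (Q - P))) (at t)"
      using has_vector_derivative_linepath_within[of P Q t UNIV] by (simp add: L_def has_vector_derivative_def)
    from diff_chain_at[OF this der[OF LR[OF t]]]
    have "(G \<circ> L has_derivative (\<lambda>h. h *\<^sub>R G' (L t) (Q - P))) (at t)"
      using has_derivative_linear[OF der[OF LR[OF t]]] by (simp add: o_def linear_cmul)
    then have "((\<lambda>t. G (L t)) has_real_derivative G' (L t) (Q - P)) (at t)"
      by (simp add: has_real_derivative_iff_has_vector_derivative has_vector_derivative_def o_def)
    then have "((\<lambda>t. e * G (L t)) has_real_derivative e * G' (L t) (Q - P)) (at t)" by (rule DERIV_cmult)
    then show "((\<lambda>t. e * G (L t)) has_real_derivative indicator {0..1} t *\<^sub>R (w (L t) * norm (Q - P))) (at t)"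
      using eq[OF t] t by simp
    show "0 \<le> indicator {0..1} t *\<^sub>R (w (L t) * norm (Q - P))"
      using nonneg[OF LR[OF t]] by simp
  qed simp
  also have "\<dots> = ennreal (e * G Q - e * G P)" by (simp add: L_def linepath_def)
  also have "\<dots> \<le> (\<integral>\<^sup>+t\<in>{0..1}. ennreal (w (\<gamma> t) * norm (velocity \<gamma> t)) \<partial>lborel)"
  proof -
    have "e * G' x v \<le> w x * norm v" if "x \<in> R" for x v
      using bound[OF that, of v] by (auto simp: e_def)
    moreover have "((\<lambda>x. e * G x) has_derivative (\<lambda>v. e * G' x v)) (at x)" if "x \<in> R" for x
      using der[OF that] by (rule has_derivative_mult_right)
    ultimately have "ennreal (e * G (pathfinish \<gamma>) - e * G (pathstart \<gamma>))
        \<le> (\<integral>\<^sup>+t\<in>{0..1}. ennreal (w (\<gamma> t) * norm (velocity \<gamma> t)) \<partial>lborel)"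
      using \<gamma>(1,2) cont nonneg by (intro length_ge_calibration[where R = R and G' = "\<lambda>x v. e * G' x v"])
    with \<gamma>(3,4) show ?thesis by simp
  qed
  also have "\<dots> = riemannian_length g \<gamma>"
    unfolding riemannian_length_def using \<gamma>(2)
    by (intro nn_integral_cong) (auto simp: g path_image_def indicator_def image_subset_iff)
  finally show "riemannian_length g (linepath P Q) \<le> riemannian_length g \<gamma>" by (simp add: L_def)
qed

text \<open>By \<open>rel\<close> the ray of slope \<open>\<tau>\<close> is \<open>z = 0\<close>.
  The hypothesis \<open>ineq\<close> is the gradient bound written in the coordinate
  \<open>z\<close>; as it is given only for \<open>z < \<delta>\<close>, the slope
  \<open>\<phi>\<^sub>1\<close> is taken so close to \<open>\<tau>\<close> that
  \<open>z < \<delta>\<close> on the whole region.\<close>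

lemma canonical_metric_ray_minimizing:
  fixes n p :: nat and lam \<sigma> \<tau> s \<delta> :: real
  assumes np: "0 < p" "p < n" and lam: "0 < lam" and \<sigma>: "0 \<le> \<sigma>" and \<tau>: "0 < \<tau>"
    and rel: "p * lam\<^sup>2 * (1 + \<tau>\<^sup>2) = n * (1 + lam\<^sup>2 * \<tau>\<^sup>2)"
    and \<delta>: "0 < \<delta>"
    and ineq: "\<And>z::real. n / lam\<^sup>2 - p < z \<Longrightarrow> z < \<delta> \<Longrightarrow> - real p < z \<Longrightarrow> z < real (n - p) \<Longrightarrow>
      exp ((2 * s - 1) * (p * ln (1 + z / p) + real (n - p) * ln (1 - z / real (n - p)))) *
      (1 + s\<^sup>2 * (4 * (real n)\<^sup>2 / (real n + 1)\<^sup>2) * z\<^sup>2 * (p + z - n / lam\<^sup>2) / ((p + z)\<^sup>2 * (real (n - p) - z))) \<le> 1"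
  shows "\<exists>\<phi>\<^sub>1 > \<tau>. ray_length_minimizing_in (canonical_metric \<sigma> lam n p)
           {(r, \<rho>). r > 0 \<and> \<rho> = \<tau> * r} (angular_region \<phi>\<^sub>1)"
proof -

  \<comment> \<open>Constants and the opening of the region\<close>
  define \<Lambda> where "\<Lambda> = lam\<^sup>2"
  define q where "q = real (n - p)"
  have q: "q > 0" "real n = real p + q" using np by (auto simp: q_def)
  have p0: "real p > 0" using np by simp
  have \<Lambda>0: "\<Lambda> > 0" using lam by (simp add: \<Lambda>_def)
  have rel': "p * \<Lambda> * (1 + \<tau>\<^sup>2) = n * (1 + \<Lambda> * \<tau>\<^sup>2)" using rel by (simp add: \<Lambda>_def)
  \<comment> \<open>On the region \<open>q - z\<close> and \<open>p + z - n / \<Lambda>\<close> are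
    positive multiples of \<open>\<Lambda> - 1\<close>, so this settles their sign.\<close>
  have \<Lambda>1: "\<Lambda> > 1"
  proof -
    have "p * (\<Lambda> - 1) = q * (1 + \<Lambda> * \<tau>\<^sup>2)" using rel' unfolding q(2) by (simp add: algebra_simps)
    also have "\<dots> > 0" using q \<Lambda>0 by (intro mult_pos_pos add_pos_nonneg) auto
    finally show ?thesis using p0 by (simp add: zero_less_mult_iff)
  qed
  \<comment> \<open>\<open>c y\<close> is the value of \<open>z\<close> on the ray of slope
    \<open>y\<close>. It increases for \<open>y \<ge> 0\<close> and vanishes at
    \<open>\<tau>\<close>.\<close>
  define c where "c y = q - n * (\<Lambda> - 1) / (\<Lambda> * (1 + y\<^sup>2))" for y :: real
  have c\<tau>: "c \<tau> = 0"
  proof -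
    have "n * (\<Lambda> - 1) = q * (\<Lambda> * (1 + \<tau>\<^sup>2))" using rel' unfolding q(2) by (simp add: algebra_simps)
    moreover have "1 + \<tau>\<^sup>2 > 0" by (simp add: add_pos_nonneg)
    ultimately show ?thesis using \<Lambda>0 by (simp add: c_def)
  qed
  have "isCont c \<tau>"
  proof -
    have "1 + \<tau>\<^sup>2 > 0" by (simp add: add_pos_nonneg)
    then show ?thesis unfolding c_def using \<Lambda>0 by (intro continuous_intros) auto
  qed
  then have "c \<midarrow>\<tau>\<rightarrow> 0" using c\<tau> by (simp add: isCont_def)
  then have "eventually (\<lambda>y. c y < \<delta>) (at \<tau>)" using \<delta> by (rule order_tendstoD)
  then obtain d where d: "d > 0" "\<And>y. y \<noteq> \<tau> \<Longrightarrow> dist y \<tau> < d \<Longrightarrow> c y < \<delta>"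
    unfolding eventually_at by auto
  define \<phi> where "\<phi> = \<tau> + d / 2"
  have \<phi>: "\<phi> > \<tau>" "c \<phi> < \<delta>" using d by (auto simp: \<phi>_def dist_real_def)

  \<comment> \<open>The calibrating function and the angular coordinate\<close>
  define R where "R = angular_region \<phi>"
  define A where "A x = (fst x)\<^sup>2 + \<Lambda> * (snd x)\<^sup>2" for x :: "real \<times> real"
  define N where "N x = (fst x)\<^sup>2 + (snd x)\<^sup>2" for x :: "real \<times> real"
  \<comment> \<open>\<open>c0\<close> normalises \<open>e\<close>, the logarithm of E, to vanish on
    the ray. It collects the constant factors of \<open>1 + z/p\<close> and \<open>1 - z/q\<close>
    when these are written as multiples of \<open>A / N\<close> and
    \<open>(fst x)^2 / N\<close>.\<close>
  define c0 where "c0 = p * ln (n / (p * \<Lambda>)) + q * ln (n * (\<Lambda> - 1) / (q * \<Lambda>))"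
  define e where "e x = p * ln (A x) + 2 * q * ln (fst x) - n * ln (N x) + c0" for x :: "real \<times> real"
  \<comment> \<open>The length density \<open>w\<close> equals
    \<open>\<sigma> * exp ((e - c0 + n * ln N) / 2)\<close>, whence the term
    \<open>- c0 / 2\<close>. The factor \<open>1 / (n + 1)\<close> compensates the degree of
    homogeneity \<open>n + 1\<close> of \<open>G\<close>.\<close>
  define G where "G x = \<sigma> / (n + 1) * exp (s * e x - c0 / 2 + (n + 1) / 2 * ln (N x))" for x :: "real \<times> real"
  define w where "w x = \<sigma> * sqrt (A x ^ p * fst x ^ (2 * (n - p)))" for x :: "real \<times> real"
  define Lr where "Lr x = s * (2 * p * fst x / A x + 2 * q / fst x - 2 * n * fst x / N x) + (n + 1) * fst x / N x" for x :: "real \<times> real"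
  define L\<rho> where "L\<rho> x = s * (2 * p * \<Lambda> * snd x / A x - 2 * n * snd x / N x) + (n + 1) * snd x / N x" for x :: "real \<times> real"
  define G' where "G' x h = G x * (Lr x * fst h + L\<rho> x * snd h)" for x h :: "real \<times> real"
  have pos: "fst x > 0" "snd x > 0" "A x > 0" "N x > 0" if "x \<in> R" for x :: "real \<times> real"
    using that \<Lambda>0 by (auto simp: R_def angular_region_def A_def N_def add_pos_pos)
  \<comment> \<open>In this coordinate the three factors of \<open>ineq\<close> are constant
    multiples of \<open>A / N\<close>, \<open>(fst x)^2 / N\<close> and
    \<open>(snd x)^2 / N\<close>.\<close>
  define z where "z x = n * A x / (\<Lambda> * N x) - p" for x :: "real \<times> real"
  have z: "p + z x = n * A x / (\<Lambda> * N x)" "q - z x = n * (\<Lambda> - 1) * (fst x)\<^sup>2 / (\<Lambda> * N x)"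
      "p + z x - n / \<Lambda> = n * (\<Lambda> - 1) * (snd x)\<^sup>2 / (\<Lambda> * N x)" if "N x > 0" for x :: "real \<times> real"
  proof -
    show "p + z x = n * A x / (\<Lambda> * N x)" by (simp add: z_def)
    have "q - z x = n - n * A x / (\<Lambda> * N x)" by (simp add: z_def q)
    also have "\<dots> = n * (\<Lambda> - 1) * (fst x)\<^sup>2 / (\<Lambda> * N x)"
      using that \<Lambda>0 by (simp add: field_simps) (simp add: A_def N_def algebra_simps)
    finally show "q - z x = n * (\<Lambda> - 1) * (fst x)\<^sup>2 / (\<Lambda> * N x)" .
    show "p + z x - n / \<Lambda> = n * (\<Lambda> - 1) * (snd x)\<^sup>2 / (\<Lambda> * N x)"
      using that \<Lambda>0 by (simp add: z_def field_simps) (simp add: A_def N_def algebra_simps)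
  qed
  have e: "p * ln (1 + z x / p) + q * ln (1 - z x / q) = e x" if "fst x > 0" for x :: "real \<times> real"
  proof -
    have NA: "N x > 0" "A x > 0" using that \<Lambda>0 by (auto simp: N_def A_def add_pos_nonneg)
    have "1 + z x / p = (p + z x) / p" "1 - z x / q = (q - z x) / q" using p0 q by (simp_all add: field_simps)
    then have eq: "1 + z x / p = n / (p * \<Lambda>) * (A x / N x)"
      "1 - z x / q = n * (\<Lambda> - 1) / (q * \<Lambda>) * ((fst x)\<^sup>2 / N x)" unfolding z[OF NA(1)] by simp_all
    define a b where "a = ln (n / (p * \<Lambda>))" and "b = ln (n * (\<Lambda> - 1) / (q * \<Lambda>))"
    have "n / (p * \<Lambda>) > 0" "n * (\<Lambda> - 1) / (q * \<Lambda>) > 0" using p0 q np \<Lambda>0 \<Lambda>1 by simp_all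
    then have l: "ln (1 + z x / p) = a + (ln (A x) - ln (N x))"
      "ln (1 - z x / q) = b + (2 * ln (fst x) - ln (N x))"
      unfolding eq a_def b_def using NA that by (simp_all only: ln_mult_pos ln_div ln_realpow divide_pos_pos zero_less_power) simp_all
    show ?thesis unfolding l e_def c0_def a_def[symmetric] b_def[symmetric] by (simp add: q(2) algebra_simps)
  qed
  have wexp: "w x = \<sigma> * exp ((e x - c0 + n * ln (N x)) / 2)" if "fst x > 0" for x :: "real \<times> real"
  proof -
    have NA: "N x > 0" "A x > 0" using that \<Lambda>0 by (auto simp: N_def A_def add_pos_nonneg)
    have "exp (2 * q * ln (fst x)) = fst x ^ (2 * (n - p))"
      using exp_of_nat_mult[of "2 * (n - p)" "ln (fst x)"] that by (simp add: q_def)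
    then have "A x ^ p * fst x ^ (2 * (n - p)) = exp (e x - c0 + n * ln (N x))"
      using NA by (simp add: e_def exp_add exp_of_nat_mult)
    also have "\<dots> = (exp ((e x - c0 + n * ln (N x)) / 2))\<^sup>2" by (simp add: exp_double[symmetric])
    finally show ?thesis by (simp add: w_def)
  qed

  \<comment> \<open>The differential of the calibrating function\<close>
  have der: "(G has_derivative G' x) (at x)" if x: "x \<in> R" for x :: "real \<times> real"
  proof -
    note p = pos[OF x]
    have dA: "(A has_derivative (\<lambda>h. 2 * fst x * fst h + \<Lambda> * (2 * snd x * snd h))) (at x)"
      unfolding A_def by (auto intro!: derivative_eq_intros)
    have dN: "(N has_derivative (\<lambda>h. 2 * fst x * fst h + 2 * snd x * snd h)) (at x)"
      unfolding N_def by (auto intro!: derivative_eq_intros)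
    have ln: "((\<lambda>x. ln (g x)) has_derivative (\<lambda>h. g' h * inverse (g x))) (at x)"
      if "(g has_derivative g') (at x)" "g x > 0" for g :: "real \<times> real \<Rightarrow> real" and g'
      using that by (auto intro!: derivative_eq_intros)
    have exp: "((\<lambda>x. exp (g x)) has_derivative (\<lambda>h. g' h * exp (g x))) (at x)"
      if "(g has_derivative g') (at x)" for g :: "real \<times> real \<Rightarrow> real" and g'
      using that by (auto intro!: derivative_eq_intros)
    have de: "(e has_derivative (\<lambda>h. p * ((2 * fst x * fst h + \<Lambda> * (2 * snd x * snd h)) * inverse (A x))
        + 2 * q * (fst h * inverse (fst x)) - n * ((2 * fst x * fst h + 2 * snd x * snd h) * inverse (N x)))) (at x)"
    proof -
      have dr: "((\<lambda>x. fst x) has_derivative (\<lambda>h. fst h)) (at x)" by (auto intro!: derivative_eq_intros)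
      note has_derivative_add[OF has_derivative_diff[OF has_derivative_add[OF
        has_derivative_mult_right[OF ln[OF dA p(3)], of "real p"]
        has_derivative_mult_right[OF ln[OF dr p(1)], of "2 * q"]]
        has_derivative_mult_right[OF ln[OF dN p(4)], of "real n"]] has_derivative_const[of c0]]
      moreover have "e = (\<lambda>x. real p * ln (A x) + 2 * q * ln (fst x) - real n * ln (N x) + c0)"
        by (rule ext) (rule e_def)
      ultimately show ?thesis by (simp only: add_0_right)
    qed
    have "((\<lambda>x. s * e x - c0 / 2 + (n + 1) / 2 * ln (N x)) has_derivative (\<lambda>h. Lr x * fst h + L\<rho> x * snd h)) (at x)"
    proof -
      note has_derivative_add[OF has_derivative_diff[OF has_derivative_mult_right[OF de, of s] has_derivative_const[of "c0 / 2"]]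
        has_derivative_mult_right[OF ln[OF dN p(4)], of "real (n + 1) / 2"]]
      then show ?thesis
      proof (rule has_derivative_eq_rhs, intro ext)
        fix h
        \<comment> \<open>The reciprocals of \<open>A\<close>, \<open>fst x\<close> and
          \<open>N\<close> are independent variables here, so that a polynomial identity
          remains.\<close>
        have "s * (P * ((2 * a * h1 + \<Lambda> * (2 * b * h2)) * Ai) + 2 * q * (h1 * ai) - M * ((2 * a * h1 + 2 * b * h2) * Ni)) - 0
            + (M + 1) / 2 * ((2 * a * h1 + 2 * b * h2) * Ni)
          = (s * (2 * P * a * Ai + 2 * q * ai - 2 * M * a * Ni) + (M + 1) * a * Ni) * h1
            + (s * (2 * P * \<Lambda> * b * Ai - 2 * M * b * Ni) + (M + 1) * b * Ni) * h2"
          for P M a b h1 h2 Ai ai Ni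
          by (simp add: field_simps)
        from this[of p "fst x" "fst h" "snd x" "snd h" "inverse (A x)" "inverse (fst x)" n "inverse (N x)"]
        show "s * (p * ((2 * fst x * fst h + \<Lambda> * (2 * snd x * snd h)) * inverse (A x))
           + 2 * q * (fst h * inverse (fst x)) - n * ((2 * fst x * fst h + 2 * snd x * snd h) * inverse (N x))) - 0
           + real (n + 1) / 2 * ((2 * fst x * fst h + 2 * snd x * snd h) * inverse (N x))
          = Lr x * fst h + L\<rho> x * snd h"
          by (simp only: Lr_def L\<rho>_def divide_inverse of_nat_add of_nat_1 of_nat_mult of_nat_numeral)
      qed
    qed
    from has_derivative_mult_right[OF exp[OF this], of "\<sigma> / (n + 1)"]
    have "((\<lambda>x. \<sigma> / (n + 1) * exp (s * e x - c0 / 2 + (n + 1) / 2 * ln (N x))) has_derivative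
        (\<lambda>h. \<sigma> / (n + 1) * ((Lr x * fst h + L\<rho> x * snd h) * exp (s * e x - c0 / 2 + (n + 1) / 2 * ln (N x))))) (at x)" .
    moreover have "G = (\<lambda>x. \<sigma> / (n + 1) * exp (s * e x - c0 / 2 + (n + 1) / 2 * ln (N x)))"
      by (rule ext) (rule G_def)
    moreover have "G' x = (\<lambda>h. \<sigma> / (n + 1) * ((Lr x * fst h + L\<rho> x * snd h) * exp (s * e x - c0 / 2 + (n + 1) / 2 * ln (N x))))"
      by (rule ext) (simp only: G'_def G_def mult_ac)
    ultimately show ?thesis by (simp only:)
  qed

  \<comment> \<open>Radial and angular components of the gradient\<close>
  have LL: "Lr x = s * (2 * real p * fst x * inverse (A x) + 2 * q * inverse (fst x) - 2 * real n * fst x * inverse (N x))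
        + (real n + 1) * fst x * inverse (N x)"
    "L\<rho> x = s * (2 * real p * \<Lambda> * snd x * inverse (A x) - 2 * real n * snd x * inverse (N x))
        + (real n + 1) * snd x * inverse (N x)" for x :: "real \<times> real"
    by (simp_all only: Lr_def L\<rho>_def divide_inverse of_nat_add of_nat_1 of_nat_mult of_nat_numeral)
  \<comment> \<open>\<open>G = \<sigma>/(n+1) exp (L - c0/2)\<close> with \<open>(Lr, L\<rho>)\<close> the gradient of \<open>L\<close>\<close>
  have radial: "fst x * Lr x + snd x * L\<rho> x = n + 1" if x: "x \<in> R" for x :: "real \<times> real"
  proof -
    note p = pos[OF x]
    have "a * (s * (2 * P * a * Ai + 2 * q * ai - 2 * M * a * Ni) + (M + 1) * a * Ni)
        + b * (s * (2 * P * \<Lambda> * b * Ai - 2 * M * b * Ni) + (M + 1) * b * Ni)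
      = s * (2 * P * ((a\<^sup>2 + \<Lambda> * b\<^sup>2) * Ai) + 2 * q * (a * ai) - 2 * M * ((a\<^sup>2 + b\<^sup>2) * Ni))
        + (M + 1) * ((a\<^sup>2 + b\<^sup>2) * Ni)" for P M a b Ai ai Ni
      by (simp add: algebra_simps power2_eq_square)
    from this[of "fst x" p "inverse (A x)" "inverse (fst x)" n "inverse (N x)" "snd x"]
    have "fst x * Lr x + snd x * L\<rho> x = s * (2 * real p * (A x * inverse (A x)) + 2 * q * (fst x * inverse (fst x))
        - 2 * real n * (N x * inverse (N x))) + (real n + 1) * (N x * inverse (N x))"
      unfolding LL A_def[of x, symmetric] N_def[of x, symmetric] .
    then show ?thesis using p by (simp add: q)
  qed
  \<comment> \<open>Powers of \<open>N\<close> are rotation invariant and drop out. What remains is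
    \<open>s\<close> times the rotational derivative of \<open>e\<close>, proportional to
    \<open>z\<close> and therefore zero on the ray.\<close>
  have angular: "fst x * L\<rho> x - snd x * Lr x = - (2 * s * \<Lambda> * N x * z x * snd x / (fst x * A x))" if x: "x \<in> R" for x :: "real \<times> real"
  proof -
    note p = pos[OF x]
    have "a * (s * (2 * P * \<Lambda> * b * Ai - 2 * M * b * Ni) + (M + 1) * b * Ni)
        - b * (s * (2 * P * a * Ai + 2 * q * ai - 2 * M * a * Ni) + (M + 1) * a * Ni)
      = 2 * s * b * (P * (\<Lambda> - 1) * a * Ai - q * ai)" for P M a b Ai ai Ni
      by (simp add: algebra_simps)
    from this[of "fst x" p "snd x" "inverse (A x)" n "inverse (N x)" "inverse (fst x)"]
    have "fst x * L\<rho> x - snd x * Lr x = 2 * s * snd x * (p * (\<Lambda> - 1) * fst x / A x - q / fst x)"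
      unfolding LL by (simp only: divide_inverse)
    also have "p * (\<Lambda> - 1) * fst x / A x - q / fst x = (p * (\<Lambda> - 1) * (fst x)\<^sup>2 - q * A x) / (fst x * A x)"
      using p by (simp add: field_simps power2_eq_square)
    also have "p * (\<Lambda> - 1) * (fst x)\<^sup>2 - q * A x = - (\<Lambda> * N x * z x)"
    proof -
      have "\<Lambda> * N x * z x = n * A x - p * \<Lambda> * N x" using p \<Lambda>0 by (simp add: z_def field_simps)
      then show ?thesis by (simp add: A_def N_def q algebra_simps)
    qed
    finally show ?thesis by simp
  qed
  have zrange: "n / \<Lambda> - p < z x" "z x < \<delta>" "- real p < z x" "z x < q" if x: "x \<in> R" for x :: "real \<times> real"
  proof -
    note p = pos[OF x] and zz = z[OF pos(4)[OF x]]
    have n0: "real n > 0" using np by simp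
    have "p + z x - n / \<Lambda> > 0" unfolding zz(3) using p n0 \<Lambda>0 \<Lambda>1 by simp
    moreover have "p + z x > 0" unfolding zz(1) using p n0 \<Lambda>0 by simp
    moreover have "q - z x > 0" unfolding zz(2) using p n0 \<Lambda>0 \<Lambda>1 by simp
    ultimately show "n / \<Lambda> - p < z x" "- real p < z x" "z x < q" by linarith+
    \<comment> \<open>\<open>z\<close> grows with the slope, so on the region it is at most
      \<open>c \<phi>\<close>, its value on the bounding ray.\<close>
    have "snd x \<le> \<phi> * fst x" using x by (auto simp: R_def angular_region_def)
    then have "(snd x)\<^sup>2 \<le> (\<phi> * fst x)\<^sup>2" using p by (intro power_mono) auto
    then have Nle: "N x \<le> (1 + \<phi>\<^sup>2) * (fst x)\<^sup>2" by (simp add: N_def power_mult_distrib algebra_simps)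
    have "n * (\<Lambda> - 1) / (\<Lambda> * (1 + \<phi>\<^sup>2)) = n * (\<Lambda> - 1) * (fst x)\<^sup>2 / (\<Lambda> * ((1 + \<phi>\<^sup>2) * (fst x)\<^sup>2))"
      using p by simp
    also have "\<dots> \<le> n * (\<Lambda> - 1) * (fst x)\<^sup>2 / (\<Lambda> * N x)"
      using p n0 \<Lambda>0 \<Lambda>1 Nle by (intro divide_left_mono mult_left_mono mult_pos_pos) (auto simp: add_pos_nonneg)
    finally have "z x \<le> c \<phi>" using zz(2) by (simp add: c_def)
    then show "z x < \<delta>" using \<phi> by simp
  qed

  \<comment> \<open>The gradient bound\<close>
  have grad: "G x * sqrt ((Lr x)\<^sup>2 + (L\<rho> x)\<^sup>2) \<le> w x" if x: "x \<in> R" for x :: "real \<times> real"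
  proof -
    note p = pos[OF x] and zz = z[OF pos(4)[OF x]]
    \<comment> \<open>\<open>X\<close> is the squared ratio of the angular to the radial component.
      By Lagrange's identity \<open>N * (Lr^2 + L\<rho>^2) = (n + 1)^2 * (1 + X)\<close>, so the
      squared length of the gradient of \<open>G\<close> is
      \<open>w^2 * exp ((2 * s - 1) * e) * (1 + X)\<close>, and \<open>ineq\<close> applies.\<close>
    define X where "X = s\<^sup>2 * (4 * (real n)\<^sup>2 / (real n + 1)\<^sup>2) * (z x)\<^sup>2 * (p + z x - n / \<Lambda>) / ((p + z x)\<^sup>2 * (q - z x))"
    have I: "exp ((2 * s - 1) * e x) * (1 + X) \<le> 1"
      using ineq[of "z x"] zrange[OF x] e[OF p(1)] by (simp add: X_def \<Lambda>_def q_def)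
    have n0: "real n > 0" using np by simp
    have "X * (real n + 1)\<^sup>2 = (2 * s * \<Lambda> * N x * z x * snd x / (fst x * A x))\<^sup>2"
      unfolding X_def unfolding zz(3) unfolding zz(1,2) using p n0 \<Lambda>0 \<Lambda>1
      by (simp add: divide_simps)
    note X = this
    have "N x * ((Lr x)\<^sup>2 + (L\<rho> x)\<^sup>2) = (real n + 1)\<^sup>2 * (1 + X)"
    proof -
      have "N x * ((Lr x)\<^sup>2 + (L\<rho> x)\<^sup>2) = (fst x * Lr x + snd x * L\<rho> x)\<^sup>2 + (fst x * L\<rho> x - snd x * Lr x)\<^sup>2"
        by (simp add: N_def power2_eq_square algebra_simps)
      also have "\<dots> = (real n + 1)\<^sup>2 + X * (real n + 1)\<^sup>2"
        unfolding radial[OF x] angular[OF x] X by simp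
      finally show ?thesis by (simp add: algebra_simps)
    qed
    then have NL: "(Lr x)\<^sup>2 + (L\<rho> x)\<^sup>2 = (real n + 1)\<^sup>2 * (1 + X) / N x" using p by (simp add: field_simps)
    have "(G x)\<^sup>2 * ((Lr x)\<^sup>2 + (L\<rho> x)\<^sup>2) = \<sigma>\<^sup>2 * (exp (s * e x - c0 / 2 + (n + 1) / 2 * ln (N x)))\<^sup>2 / N x * (1 + X)"
      unfolding NL G_def by (simp add: power_mult_distrib power_divide add.commute)
    also have "(exp (s * e x - c0 / 2 + (n + 1) / 2 * ln (N x)))\<^sup>2 = exp ((e x - c0 + n * ln (N x)) + (2 * s - 1) * e x + ln (N x))"
      by (simp add: exp_double[symmetric] algebra_simps)
    also have "\<sigma>\<^sup>2 * \<dots> / N x * (1 + X) = \<sigma>\<^sup>2 * exp (e x - c0 + n * ln (N x)) * (exp ((2 * s - 1) * e x) * (1 + X))"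
      using p by (simp add: exp_add)
    also have "\<dots> \<le> \<sigma>\<^sup>2 * exp (e x - c0 + n * ln (N x)) * 1"
      using I by (intro mult_left_mono) auto
    also have "\<dots> = (w x)\<^sup>2" unfolding wexp[OF p(1)]
      by (simp add: power_mult_distrib exp_double[symmetric])
    finally have "(G x * sqrt ((Lr x)\<^sup>2 + (L\<rho> x)\<^sup>2))\<^sup>2 \<le> (w x)\<^sup>2" by (simp add: power_mult_distrib)
    moreover have "0 \<le> w x" using \<sigma> by (simp add: wexp[OF p(1)])
    ultimately show ?thesis by (rule power2_le_imp_le)
  qed

  \<comment> \<open>Application of the calibration criterion\<close>
  have "ray_length_minimizing_in (canonical_metric \<sigma> lam n p) {(r, \<rho>). r > 0 \<and> \<rho> = \<tau> * r} R"
  proof (rule ray_length_minimizing_by_calibration[OF refl, where G = G and w = w and G' = G'])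
    show "{(r, \<rho>). r > 0 \<and> \<rho> = \<tau> * r} \<subseteq> R"
      using \<phi> \<tau> by (auto simp: R_def angular_region_def)
    show "sqrt (canonical_metric \<sigma> lam n p x v v) = w x * norm v" if "x \<in> R" for x v :: "real \<times> real"
      using \<sigma> by (cases x) (simp add: canonical_metric_def w_def A_def \<Lambda>_def norm_eq_sqrt_inner real_sqrt_mult mult.assoc)
    show "(G has_derivative G' x) (at x)" if "x \<in> R" for x by (rule der[OF that])
    show "\<bar>G' x v\<bar> \<le> w x * norm v" if x: "x \<in> R" for x v :: "real \<times> real"
    proof -
      have "\<bar>G' x v\<bar> = G x * \<bar>(Lr x, L\<rho> x) \<bullet> v\<bar>" using \<sigma> by (cases v) (simp add: G'_def abs_mult G_def)
      also have "\<dots> \<le> G x * (norm (Lr x, L\<rho> x) * norm v)"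
        using \<sigma> by (intro mult_left_mono Cauchy_Schwarz_ineq2) (simp add: G_def)
      also have "\<dots> = (G x * sqrt ((Lr x)\<^sup>2 + (L\<rho> x)\<^sup>2)) * norm v" by (simp add: norm_prod_def)
      also have "\<dots> \<le> w x * norm v" using grad[OF x] by (intro mult_right_mono) auto
      finally show ?thesis .
    qed
    show "continuous_on R w" unfolding w_def A_def by (intro continuous_intros)
    show "0 \<le> w x" if "x \<in> R" for x using \<sigma> pos[OF that] by (simp add: w_def)
    fix r :: real assume r: "r > 0"
    define x where "x = (r, \<tau> * r)"
    have x: "x \<in> R" using \<phi> \<tau> r by (auto simp: x_def R_def angular_region_def)
    note p = pos[OF x]
    have Nx: "N x = r\<^sup>2 * (1 + \<tau>\<^sup>2)" by (simp add: N_def x_def algebra_simps power_mult_distrib)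
    have "z x = c \<tau>" using z(2)[OF p(4)] r unfolding Nx by (simp add: c_def x_def power2_eq_square)
    then have e0: "e x = 0" using e[OF p(1)] c\<tau> by simp
    \<comment> \<open>On the ray the direction is radial and \<open>e = 0\<close>, so both sides
      equal \<open>(n + 1) * G x\<close>, which is \<open>w x\<close> times the square root of
      \<open>N x\<close>.\<close>
    have "r * G' x (1, \<tau>) = G x * (fst x * Lr x + snd x * L\<rho> x)" by (simp add: G'_def x_def algebra_simps)
    also have "\<dots> = \<sigma> * exp ((e x - c0 + n * ln (N x)) / 2 + ln (N x) / 2)"
    proof -
      have "s * 0 - c0 / 2 + real (n + 1) / 2 * ln (N x) = (0 - c0 + n * ln (N x)) / 2 + ln (N x) / 2"
        by (simp add: field_simps)
      then show ?thesis unfolding radial[OF x] G_def e0 by simp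
    qed
    also have "\<dots> = w x * exp (ln (N x) / 2)" by (simp add: wexp[OF p(1)] exp_add)
    also have "exp (ln (N x) / 2) = r * norm (1 :: real, \<tau>)"
    proof -
      have "(exp (ln (N x) / 2))\<^sup>2 = N x" using p by (simp add: exp_double[symmetric])
      also have "\<dots> = (r * norm (1 :: real, \<tau>))\<^sup>2" unfolding Nx by (simp add: norm_prod_def power_mult_distrib)
      finally show ?thesis using r by (simp add: power2_eq_iff_nonneg)
    qed
    finally show "G' (r, \<tau> * r) (1, \<tau>) = w (r, \<tau> * r) * norm (1 :: real, \<tau>)" using r by (simp add: x_def)
  qed
  then show ?thesis using \<phi>(1) unfolding R_def by blast
qed

section \<open>Smooth maps\<close>

lemma Ck_on_cong:
  assumes "open U" "Ck_on k U F" "\<And>x. x \<in> U \<Longrightarrow> F x = H x"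
  shows "Ck_on k U H"
  using assms(2,3)
proof (induction k arbitrary: F H)
  case 0
  then show ?case by (simp cong: continuous_on_cong)
next
  case (Suc k)
  have "H differentiable (at x)" if "x \<in> U" for x
    using Suc.prems that \<open>open U\<close> unfolding differentiable_def
    by (metis Ck_on.simps(2) differentiable_def has_derivative_transform_within_open)
  moreover have "frechet_derivative F (at x) = frechet_derivative H (at x)" if "x \<in> U" for x
    using Suc.prems that \<open>open U\<close> by (intro frechet_derivative_transform_within_open[where X = U]) auto
  ultimately show ?case
    using Suc.prems Suc.IH[of "\<lambda>x. frechet_derivative F (at x) _" "\<lambda>x. frechet_derivative H (at x) _"] by auto
qed

lemma smooth_on_open_cong:
  "smooth_on_open U F \<Longrightarrow> (\<And>x. x \<in> U \<Longrightarrow> F x = H x) \<Longrightarrow> smooth_on_open U H"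
  unfolding smooth_on_open_def using Ck_on_cong by blast

lemma smooth_on_open_differentiable:
  "smooth_on_open U F \<Longrightarrow> x \<in> U \<Longrightarrow> F differentiable (at x)"
  unfolding smooth_on_open_def by (metis Ck_on.simps(2))

lemma smooth_on_open_has_derivative:
  "smooth_on_open U F \<Longrightarrow> x \<in> U \<Longrightarrow> (F has_derivative frechet_derivative F (at x)) (at x)"
  using smooth_on_open_differentiable frechet_derivative_works by blast

lemma smooth_on_open_derivative:
  "smooth_on_open U F \<Longrightarrow> smooth_on_open U (\<lambda>x. frechet_derivative F (at x) v)"
  unfolding smooth_on_open_def by (metis Ck_on.simps(2))

lemma smooth_on_open_continuous: "smooth_on_open U F \<Longrightarrow> continuous_on U F"
  unfolding smooth_on_open_def by (metis Ck_on.simps(1))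

text \<open>Lets an explicitly given derivative stand for \<open>frechet_derivative\<close>; the two
  agree on \<open>U\<close> by uniqueness.\<close>

lemma Ck_on_SucI:
  assumes "open U" "\<And>x. x \<in> U \<Longrightarrow> (F has_derivative F' x) (at x)"
    and "\<And>v. Ck_on k U (\<lambda>x. F' x v)"
  shows "Ck_on (Suc k) U F"
proof -
  have "frechet_derivative F (at x) = F' x" if "x \<in> U" for x
    using frechet_derivative_at[OF assms(2)[OF that]] by simp
  then have "Ck_on k U (\<lambda>x. frechet_derivative F (at x) v)" for v
    using assms(3)[of v] \<open>open U\<close> by (metis (mono_tags, lifting) Ck_on_cong)
  then show ?thesis using assms(2) by (auto simp: differentiable_def)
qed

lemma smooth_on_open_linear:
  assumes "smooth_on_open U F" "bounded_linear L"
  shows "smooth_on_open U (\<lambda>x. L (F x))"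
proof -
  have "open U" using assms(1) by (simp add: smooth_on_open_def)
  have "Ck_on k U (\<lambda>x. L (F x))" if "smooth_on_open U F" for k F
    using that
  proof (induction k arbitrary: F)
    case 0
    then show ?case
      using smooth_on_open_continuous bounded_linear.continuous_on[OF assms(2)] by auto
  next
    case (Suc k)
    show ?case
      using bounded_linear.has_derivative[OF assms(2) smooth_on_open_has_derivative[OF Suc.prems]]
      by (rule Ck_on_SucI[OF \<open>open U\<close>]) (auto intro: Suc.IH smooth_on_open_derivative[OF Suc.prems])
  qed
  then show ?thesis using assms(1) by (simp add: smooth_on_open_def)
qed

lemma Ck_on_const: "Ck_on k U (\<lambda>x. c)"
  by (induction k arbitrary: c) auto

lemma Ck_on_add: "open U \<Longrightarrow> Ck_on k U F \<Longrightarrow> Ck_on k U H \<Longrightarrow> Ck_on k U (\<lambda>x. F x + H x)"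
proof (induction k arbitrary: F H)
  case 0
  then show ?case by (auto intro: continuous_on_add)
next
  case (Suc k)
  have "((\<lambda>x. F x + H x) has_derivative (\<lambda>v. frechet_derivative F (at x) v + frechet_derivative H (at x) v)) (at x)"
    if "x \<in> U" for x
    using Suc.prems that by (intro has_derivative_add) (auto simp flip: frechet_derivative_works)
  then show ?case
    by (rule Ck_on_SucI[OF Suc.prems(1)]) (use Suc in auto)
qed

lemma smooth_on_open_add:
  "smooth_on_open U F \<Longrightarrow> smooth_on_open U H \<Longrightarrow> smooth_on_open U (\<lambda>x. F x + H x)"
  unfolding smooth_on_open_def using Ck_on_add by blast

lemma Ck_on_sum:
  assumes "open U" "finite I" "\<And>i. i \<in> I \<Longrightarrow> Ck_on k U (F i)"
  shows "Ck_on k U (\<lambda>x. \<Sum>i\<in>I. F i x)"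
  using assms(2,3) by induction (auto intro: Ck_on_add[OF assms(1)] Ck_on_const)

lemma smooth_on_open_scaleR:
  fixes F :: "'a::euclidean_space \<Rightarrow> 'b::euclidean_space"
  assumes "smooth_on_open U c" "smooth_on_open U F"
  shows "smooth_on_open U (\<lambda>x. c x *\<^sub>R F x)"
proof -
  have "open U" using assms(1) by (simp add: smooth_on_open_def)
  have "Ck_on k U (\<lambda>x. c x *\<^sub>R F x)" if "smooth_on_open U c" "smooth_on_open U F" for k c and F :: "'a \<Rightarrow> 'b"
    using that
  proof (induction k arbitrary: c F)
    case 0
    then show ?case by (auto intro: continuous_on_scaleR dest: smooth_on_open_continuous)
  next
    case (Suc k)
    show ?case
      using has_derivative_scaleR[OF smooth_on_open_has_derivative[OF Suc.prems(1)]
            smooth_on_open_has_derivative[OF Suc.prems(2)]]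
      by (rule Ck_on_SucI[OF \<open>open U\<close>]) (use Suc.prems \<open>open U\<close> in \<open>auto intro!: Suc.IH smooth_on_open_derivative Ck_on_add\<close>)
  qed
  then show ?thesis using assms by (simp add: smooth_on_open_def)
qed

lemma smooth_on_open_compose_curve:
  fixes \<xi> :: "real \<Rightarrow> 'a::euclidean_space" and F :: "'a \<Rightarrow> 'b::euclidean_space"
  assumes \<xi>: "smooth_on_open I \<xi>" and F: "smooth_on_open U F" and sub: "\<xi> ` I \<subseteq> U"
  shows "smooth_on_open I (\<lambda>t. F (\<xi> t))"
proof -
  have I: "open I" using \<xi> by (simp add: smooth_on_open_def)
  \<comment> \<open>The smooth weight \<open>c\<close> makes the family closed under
    differentiation: after expansion in the basis, the chain rule yields a sum of terms of the same
    shape, with \<open>F\<close> replaced by its partial derivatives.\<close>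
  have "Ck_on k I (\<lambda>t. c t *\<^sub>R F (\<xi> t))" if "smooth_on_open U F" "smooth_on_open I c" for k F and c :: "real \<Rightarrow> real"
    using that
  proof (induction k arbitrary: c F)
    case 0
    have "continuous_on I (\<lambda>t. F (\<xi> t))"
      using smooth_on_open_continuous[OF \<xi>] smooth_on_open_continuous[OF 0(1)] sub
      by (auto intro: continuous_on_compose2)
    then show ?case using smooth_on_open_continuous[OF 0(2)] by (auto intro: continuous_on_scaleR)
  next
    case (Suc k)
    note dF = smooth_on_open_has_derivative[OF Suc.prems(1)]
    have d: "((\<lambda>t. F (\<xi> t)) has_derivative
        (\<lambda>h. frechet_derivative F (at (\<xi> t)) (frechet_derivative \<xi> (at t) h))) (at t)" if "t \<in> I" for t
      using diff_chain_at[OF smooth_on_open_has_derivative[OF \<xi> that] dF] that sub by (auto simp: o_def)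
    have expand: "frechet_derivative F (at y) v = (\<Sum>b\<in>Basis. (v \<bullet> b) *\<^sub>R frechet_derivative F (at y) b)" if "y \<in> U" for y v
    proof -
      have "linear (frechet_derivative F (at y))" using dF[OF that] by (rule has_derivative_linear)
      then show ?thesis by (subst (1) euclidean_representation[of v, symmetric]) (simp add: linear_sum linear_cmul)
    qed
    show ?case
    proof (rule Ck_on_SucI[OF I has_derivative_scaleR[OF smooth_on_open_has_derivative[OF Suc.prems(2)] d]])
      fix v
      have "Ck_on k I (\<lambda>t. (\<Sum>b\<in>Basis. (c t * (frechet_derivative \<xi> (at t) v \<bullet> b)) *\<^sub>R frechet_derivative F (at (\<xi> t)) b)
          + frechet_derivative c (at t) v *\<^sub>R F (\<xi> t))"
        using I by (intro Ck_on_add Ck_on_sum Suc.IH smooth_on_open_derivative Suc.prems finite_Basis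
          smooth_on_open_scaleR[where F = "\<lambda>t. frechet_derivative \<xi> (at t) v \<bullet> _", unfolded real_scaleR_def]
          smooth_on_open_linear[OF smooth_on_open_derivative[OF \<xi>]] bounded_linear_inner_left)
      then show "Ck_on k I (\<lambda>t. c t *\<^sub>R frechet_derivative F (at (\<xi> t)) (frechet_derivative \<xi> (at t) v)
          + frechet_derivative c (at t) v *\<^sub>R F (\<xi> t))"
      proof (rule Ck_on_cong[OF I])
        fix t assume "t \<in> I"
        then have "\<xi> t \<in> U" using sub by auto
        then show "(\<Sum>b\<in>Basis. (c t * (frechet_derivative \<xi> (at t) v \<bullet> b)) *\<^sub>R frechet_derivative F (at (\<xi> t)) b)
          + frechet_derivative c (at t) v *\<^sub>R F (\<xi> t)
          = c t *\<^sub>R frechet_derivative F (at (\<xi> t)) (frechet_derivative \<xi> (at t) v)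
          + frechet_derivative c (at t) v *\<^sub>R F (\<xi> t)"
          by (subst (2) expand) (simp_all add: scaleR_sum_right)
      qed
    qed
  qed
  from this[OF F, of "\<lambda>_. 1"] show ?thesis
    using I by (simp add: smooth_on_open_def Ck_on_const)
qed

text \<open>The derivative is again such a combination, with \<open>x\<close> and \<open>y\<close>
  replaced by multiples of \<open>y\<close> and \<open>x\<close>, so the induction runs over all
  pairs. These curves later realise the tangent vectors.\<close>

lemma smooth_on_open_great_circle:
  fixes x y :: "'a::euclidean_space"
  shows "open I \<Longrightarrow> smooth_on_open I (\<lambda>t. cos (a * t) *\<^sub>R x + sin (a * t) *\<^sub>R y)"
proof -
  assume I: "open I"
  have "Ck_on k I (\<lambda>t. cos (a * t) *\<^sub>R x + sin (a * t) *\<^sub>R y)" for k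
  proof (induction k arbitrary: x y)
    case 0
    show ?case by (auto intro!: continuous_intros)
  next
    case (Suc k)
    have "((\<lambda>t. cos (a * t) *\<^sub>R x + sin (a * t) *\<^sub>R y) has_derivative
       (\<lambda>v. cos (a * t) *\<^sub>R ((a * v) *\<^sub>R y) + sin (a * t) *\<^sub>R (- (a * v) *\<^sub>R x))) (at t)" for t
      by (auto intro!: derivative_eq_intros simp: algebra_simps)
    then show ?case by (rule Ck_on_SucI[OF I]) (rule Suc.IH)
  qed
  then show ?thesis using I by (simp add: smooth_on_open_def)
qed

section \<open>Geometry of the Lawson--Osserman submanifold\<close>

lemma smooth_curve_has_vector_derivative:
  fixes \<gamma> :: "real \<Rightarrow> 'e::euclidean_space"
  assumes "smooth_on_open I \<gamma>" "t \<in> I"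
  shows "(\<gamma> has_vector_derivative velocity \<gamma> t) (at t)"
    and "(velocity \<gamma> has_vector_derivative acceleration \<gamma> t) (at t)"
proof -
  show "(\<gamma> has_vector_derivative velocity \<gamma> t) (at t)"
    using smooth_on_open_differentiable[OF assms] by (simp add: vector_derivative_works)
  have "frechet_derivative \<gamma> (at u) 1 = velocity \<gamma> u" if "u \<in> I" for u
    using frechet_derivative_eq_vector_derivative[OF smooth_on_open_differentiable[OF assms(1) that]] by simp
  then have "smooth_on_open I (velocity \<gamma>)"
    by (rule smooth_on_open_cong[OF smooth_on_open_derivative[OF assms(1)]])
  then show "(velocity \<gamma> has_vector_derivative acceleration \<gamma> t) (at t)"
    using smooth_on_open_differentiable[OF _ assms(2)] by (simp add: vector_derivative_works)
qed

text \<open>Differentiate \<open>g t \<bullet> g t = K\<close> once and twice. Both components of a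
  curve in the Lawson-Osserman submanifold are of this kind.\<close>

lemma constant_norm_curve:
  fixes g :: "real \<Rightarrow> 'e::real_inner"
  assumes I: "open I" "0 \<in> I" and g: "\<And>t. t \<in> I \<Longrightarrow> (g has_vector_derivative g' t) (at t)"
    and g': "(g' has_vector_derivative a) (at 0)" and K: "\<And>t. t \<in> I \<Longrightarrow> g t \<bullet> g t = K"
  shows "g' 0 \<bullet> g 0 = 0" "a \<bullet> g 0 = - (g' 0 \<bullet> g' 0)"
proof -
  have inner: "((\<lambda>t. F t \<bullet> H t) has_real_derivative (F t \<bullet> H' + F' \<bullet> H t)) (at t)"
    if "(F has_vector_derivative F') (at t)" "(H has_vector_derivative H') (at t)" for F H :: "real \<Rightarrow> 'e" and F' H' t
    using has_derivative_inner[OF that[unfolded has_vector_derivative_def]]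
    by (simp add: has_real_derivative_iff_has_vector_derivative has_vector_derivative_def algebra_simps)
  have 0: "g' t \<bullet> g t = 0" if t: "t \<in> I" for t
  proof -
    have "((\<lambda>t. g t \<bullet> g t) has_real_derivative 0) (at t)"
      by (rule has_field_derivative_transform_within_open[OF DERIV_const I(1) t]) (simp add: K)
    from DERIV_unique[OF this inner[OF g[OF t] g[OF t]]] show ?thesis by (simp add: inner_commute)
  qed
  then show "g' 0 \<bullet> g 0 = 0" using I by blast
  have "((\<lambda>t. g' t \<bullet> g t) has_real_derivative 0) (at 0)"
    by (rule has_field_derivative_transform_within_open[OF DERIV_const I]) (simp add: 0)
  from DERIV_unique[OF this inner[OF g' g[OF I(2)]]] show "a \<bullet> g 0 = - (g' 0 \<bullet> g' 0)" by simp
qed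

text \<open>The geometry at one point, for an arbitrary smooth local extension \<open>F\<close> of
  \<open>f\<close>. The extension may be the one provided by smoothness on the sphere or the
  polynomial one built from spherical harmonics.\<close>

locale LO_point =
  fixes f :: "'a::euclidean_space \<Rightarrow> 'b::euclidean_space" and \<theta> :: real and x :: 'a
    and U :: "'a set" and F :: "'a \<Rightarrow> 'b"
  assumes maps: "f ` sphere 0 1 \<subseteq> sphere 0 1"
    and angle: "0 < \<theta>" "\<theta> < pi / 2"
    and x: "norm x = 1" "x \<in> U"
    and smooth: "smooth_on_open U F"
    and extends: "\<And>y. norm y = 1 \<Longrightarrow> y \<in> U \<Longrightarrow> F y = f y"
begin

abbreviation "M \<equiv> LO_submanifold f \<theta>"
abbreviation "P \<equiv> (cos \<theta> *\<^sub>R x, sin \<theta> *\<^sub>R f x)"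
abbreviation "DF \<equiv> frechet_derivative F (at x)"
text \<open>The differential at \<open>x\<close> of the map \<open>y \<mapsto> (cos \<theta>
  *\<^sub>R y, sin \<theta> *\<^sub>R F y)\<close> extending the parametrisation of
  \<open>M\<close>.\<close>

definition "J y = (cos \<theta> *\<^sub>R y, sin \<theta> *\<^sub>R DF y)"

lemma cos_sin_pos: "cos \<theta> > 0" "sin \<theta> > 0"
  using angle by (auto intro!: cos_gt_zero sin_gt_zero)

lemma norm_f: "norm y = 1 \<Longrightarrow> norm (f y) = 1"
  using maps by (auto simp: image_subset_iff)

lemma linear_DF: "linear DF"
  using has_derivative_linear[OF smooth_on_open_has_derivative[OF smooth x(2)]] .

lemma linear_J: "linear J"
  using linear_DF by (intro linearI) (simp_all add: J_def linear_add linear_cmul algebra_simps)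

text \<open>A curve in \<open>M\<close> lifts the curve
  \<open>fst (\<gamma> t) / cos \<theta>\<close> on the sphere. The interval is shrunk until the
  latter stays in \<open>U\<close>, where \<open>F\<close> replaces \<open>f\<close>.\<close>

lemma curve_coordinates:
  assumes "curve_through M P \<gamma>"
  obtains I where "open I" "0 \<in> I" 
    "\<And>t. t \<in> I \<Longrightarrow> (\<gamma> has_vector_derivative velocity \<gamma> t) (at t)"
    "\<And>t. t \<in> I \<Longrightarrow> (velocity \<gamma> has_vector_derivative acceleration \<gamma> t) (at t)"
    "\<And>t. t \<in> I \<Longrightarrow> fst (\<gamma> t) \<bullet> fst (\<gamma> t) = (cos \<theta>)\<^sup>2"
    "\<And>t. t \<in> I \<Longrightarrow> snd (\<gamma> t) \<bullet> snd (\<gamma> t) = (sin \<theta>)\<^sup>2"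
    "\<And>t. t \<in> I \<Longrightarrow> (1 / cos \<theta>) *\<^sub>R fst (\<gamma> t) \<in> U"
    "\<And>t. t \<in> I \<Longrightarrow> snd (\<gamma> t) = sin \<theta> *\<^sub>R F ((1 / cos \<theta>) *\<^sub>R fst (\<gamma> t))"
proof -
  obtain \<epsilon> where \<epsilon>: "\<epsilon> > 0" "smooth_on_open {-\<epsilon><..<\<epsilon>} \<gamma>" "\<gamma> ` {-\<epsilon><..<\<epsilon>} \<subseteq> M" and \<gamma>0: "\<gamma> 0 = P"
    using assms unfolding curve_through_def by blast
  define I where "I = {-\<epsilon><..<\<epsilon>} \<inter> (\<lambda>t. (1 / cos \<theta>) *\<^sub>R fst (\<gamma> t)) -` U"
  have c: "cos \<theta> \<noteq> 0" using cos_sin_pos by simp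
  have "open U" using smooth by (simp add: smooth_on_open_def)
  have "continuous_on {-\<epsilon><..<\<epsilon>} (\<lambda>t. (1 / cos \<theta>) *\<^sub>R fst (\<gamma> t))"
    using smooth_on_open_continuous[OF \<epsilon>(2)] by (intro continuous_intros)
  then have "open I" unfolding I_def by (rule continuous_open_preimage[OF _ _ \<open>open U\<close>]) simp
  moreover have "0 \<in> I" using \<epsilon>(1) x c by (simp add: I_def \<gamma>0)
  moreover have onM: "\<exists>y. norm y = 1 \<and> \<gamma> t = (cos \<theta> *\<^sub>R y, sin \<theta> *\<^sub>R f y)" if "t \<in> I" for t
  proof -
    have "\<gamma> t \<in> M" using \<epsilon>(3) that by (auto simp: I_def)
    then show ?thesis by (auto simp: LO_submanifold_def)
  qed
  ultimately show ?thesis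
  proof (intro that[of I])
    fix t assume t: "t \<in> I"
    then have "t \<in> {-\<epsilon><..<\<epsilon>}" by (simp add: I_def)
    from smooth_curve_has_vector_derivative[OF \<epsilon>(2) this]
    show "(\<gamma> has_vector_derivative velocity \<gamma> t) (at t)"
      "(velocity \<gamma> has_vector_derivative acceleration \<gamma> t) (at t)" .
    show U: "(1 / cos \<theta>) *\<^sub>R fst (\<gamma> t) \<in> U" using t by (simp add: I_def)
    obtain y where y: "norm y = 1" "\<gamma> t = (cos \<theta> *\<^sub>R y, sin \<theta> *\<^sub>R f y)" using onM[OF t] by blast
    show "fst (\<gamma> t) \<bullet> fst (\<gamma> t) = (cos \<theta>)\<^sup>2" "snd (\<gamma> t) \<bullet> snd (\<gamma> t) = (sin \<theta>)\<^sup>2"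
      using y(1) norm_f[OF y(1)] by (simp_all add: y(2) dot_square_norm power_mult_distrib)
    show "snd (\<gamma> t) = sin \<theta> *\<^sub>R F ((1 / cos \<theta>) *\<^sub>R fst (\<gamma> t))"
      using U extends[OF y(1)] c by (simp add: y(2))
  qed
qed

text \<open>The constant norms of both components determine the parts of the acceleration along
  \<open>x\<close> and \<open>f x\<close>. The last identity is the graph equation differentiated
  twice: apart from the image of the first component of the acceleration under \<open>DF\<close>,
  only the velocity enters.\<close>

lemma curve_velocity:
  assumes "curve_through M P \<gamma>"
  defines "y \<equiv> (1 / cos \<theta>) *\<^sub>R fst (velocity \<gamma> 0)"
  shows "velocity \<gamma> 0 = J y" "y \<bullet> x = 0" "DF y \<bullet> f x = 0"
    and "fst (acceleration \<gamma> 0) \<bullet> x = - cos \<theta> * (y \<bullet> y)"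
    and "snd (acceleration \<gamma> 0) \<bullet> f x = - sin \<theta> * (DF y \<bullet> DF y)"
    and "snd (acceleration \<gamma> 0) = sin \<theta> *\<^sub>R (DF ((1 / cos \<theta>) *\<^sub>R fst (acceleration \<gamma> 0)) +
      (\<Sum>b\<in>Basis. (y \<bullet> b) *\<^sub>R frechet_derivative (\<lambda>z. frechet_derivative F (at z) b) (at x) y))"
proof -
  have \<gamma>0: "\<gamma> 0 = P" using assms(1) unfolding curve_through_def by blast
  note c = cos_sin_pos
  obtain I where I: "open I" "0 \<in> I" 
    and d1: "\<And>t. t \<in> I \<Longrightarrow> (\<gamma> has_vector_derivative velocity \<gamma> t) (at t)"
    and d2: "\<And>t. t \<in> I \<Longrightarrow> (velocity \<gamma> has_vector_derivative acceleration \<gamma> t) (at t)"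
    and n1: "\<And>t. t \<in> I \<Longrightarrow> fst (\<gamma> t) \<bullet> fst (\<gamma> t) = (cos \<theta>)\<^sup>2"
    and n2: "\<And>t. t \<in> I \<Longrightarrow> snd (\<gamma> t) \<bullet> snd (\<gamma> t) = (sin \<theta>)\<^sup>2"
    and inU: "\<And>t. t \<in> I \<Longrightarrow> (1 / cos \<theta>) *\<^sub>R fst (\<gamma> t) \<in> U"
    and Feq: "\<And>t. t \<in> I \<Longrightarrow> snd (\<gamma> t) = sin \<theta> *\<^sub>R F ((1 / cos \<theta>) *\<^sub>R fst (\<gamma> t))"
    using curve_coordinates[OF assms(1)] by blast
  define \<xi> where "\<xi> t = (1 / cos \<theta>) *\<^sub>R fst (\<gamma> t)" for t
  define \<xi>' where "\<xi>' t = (1 / cos \<theta>) *\<^sub>R fst (velocity \<gamma> t)" for t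
  define \<xi>'' where "\<xi>'' = (1 / cos \<theta>) *\<^sub>R fst (acceleration \<gamma> 0)"
  have \<xi>0: "\<xi> 0 = x" using c by (simp add: \<xi>_def \<gamma>0)
  have y: "y = \<xi>' 0" by (simp add: y_def \<xi>'_def)
  have lin1: "bounded_linear (\<lambda>v::'a \<times> 'b. (1 / cos \<theta>) *\<^sub>R fst v)"
    by (intro bounded_linear_scaleR_right[THEN bounded_linear_compose] bounded_linear_fst)
  have \<xi>d: "(\<xi> has_vector_derivative \<xi>' t) (at t)" if "t \<in> I" for t
    unfolding \<xi>_def \<xi>'_def by (rule bounded_linear.has_vector_derivative[OF lin1 d1[OF that]])
  have \<xi>d2: "(\<xi>' has_vector_derivative \<xi>'') (at 0)"
    unfolding \<xi>'_def \<xi>''_def by (rule bounded_linear.has_vector_derivative[OF lin1 d2[OF I(2)]])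
  have fst_d: "((\<lambda>t. fst (\<gamma> t)) has_vector_derivative fst (velocity \<gamma> t)) (at t)"
    and snd_d: "((\<lambda>t. snd (\<gamma> t)) has_vector_derivative snd (velocity \<gamma> t)) (at t)"
    if "t \<in> I" for t
    using d1[OF that] by (auto intro: bounded_linear.has_vector_derivative bounded_linear_fst bounded_linear_snd)
  have fst_d2: "((\<lambda>t. fst (velocity \<gamma> t)) has_vector_derivative fst (acceleration \<gamma> 0)) (at 0)"
    and snd_d2: "((\<lambda>t. snd (velocity \<gamma> t)) has_vector_derivative snd (acceleration \<gamma> 0)) (at 0)"
    using d2[OF I(2)] by (auto intro: bounded_linear.has_vector_derivative bounded_linear_fst bounded_linear_snd)
  have v1: "fst (velocity \<gamma> 0) = cos \<theta> *\<^sub>R y" using c by (simp add: y_def)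
  note cn1 = constant_norm_curve[OF I fst_d fst_d2 n1]
  note cn2 = constant_norm_curve[OF I snd_d snd_d2 n2]
  show "y \<bullet> x = 0" using cn1(1) c unfolding v1 by (simp add: \<gamma>0)
  have "cos \<theta> * (fst (acceleration \<gamma> 0) \<bullet> x) = cos \<theta> * (- cos \<theta> * (y \<bullet> y))"
    using cn1(2) unfolding v1 by (simp add: \<gamma>0)
  then show "fst (acceleration \<gamma> 0) \<bullet> x = - cos \<theta> * (y \<bullet> y)"
    by (rule mult_left_cancel[THEN iffD1, rotated]) (use c in simp)
  \<comment> \<open>The second form is the chain rule. The first expands it in the basis, so that
    the next differentiation meets derivatives of \<open>F\<close> in fixed directions only.\<close>
  have snd_v: "snd (velocity \<gamma> t) = (\<Sum>b\<in>Basis. (\<xi>' t \<bullet> b) *\<^sub>R (sin \<theta> *\<^sub>R frechet_derivative F (at (\<xi> t)) b))"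
    "snd (velocity \<gamma> t) = sin \<theta> *\<^sub>R frechet_derivative F (at (\<xi> t)) (\<xi>' t)" if t: "t \<in> I" for t
  proof -
    have "\<xi> t \<in> U" using inU[OF t] by (simp add: \<xi>_def)
    note dF = smooth_on_open_has_derivative[OF smooth this]
    have "((\<lambda>t. F (\<xi> t)) has_vector_derivative frechet_derivative F (at (\<xi> t)) (\<xi>' t)) (at t)"
      using vector_derivative_diff_chain_within[OF \<xi>d[OF t] has_derivative_at_withinI[OF dF]] by (simp add: o_def)
    then have "((\<lambda>t. sin \<theta> *\<^sub>R F (\<xi> t)) has_vector_derivative sin \<theta> *\<^sub>R frechet_derivative F (at (\<xi> t)) (\<xi>' t)) (at t)"
      by (rule bounded_linear.has_vector_derivative[OF bounded_linear_scaleR_right])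
    then have "((\<lambda>t. snd (\<gamma> t)) has_vector_derivative sin \<theta> *\<^sub>R frechet_derivative F (at (\<xi> t)) (\<xi>' t)) (at t)"
      by (rule has_vector_derivative_transform_within_open[OF _ I(1) t]) (simp add: Feq \<xi>_def)
    then show *: "snd (velocity \<gamma> t) = sin \<theta> *\<^sub>R frechet_derivative F (at (\<xi> t)) (\<xi>' t)"
      using vector_derivative_unique_at snd_d[OF t] by blast
    have "frechet_derivative F (at (\<xi> t)) (\<xi>' t) = (\<Sum>b\<in>Basis. (\<xi>' t \<bullet> b) *\<^sub>R frechet_derivative F (at (\<xi> t)) b)"
      using has_derivative_linear[OF dF]
      by (subst (1) euclidean_representation[of "\<xi>' t", symmetric]) (simp add: linear_sum linear_cmul)
    then show "snd (velocity \<gamma> t) = (\<Sum>b\<in>Basis. (\<xi>' t \<bullet> b) *\<^sub>R (sin \<theta> *\<^sub>R frechet_derivative F (at (\<xi> t)) b))"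
      unfolding * by (simp add: scaleR_sum_right mult.commute)
  qed
  show "velocity \<gamma> 0 = J y"
    using v1 snd_v(2)[OF I(2)] by (simp add: J_def prod_eq_iff \<xi>0 y)
  have v2: "snd (velocity \<gamma> 0) = sin \<theta> *\<^sub>R DF y" using snd_v(2)[OF I(2)] by (simp add: \<xi>0 y)
  show "DF y \<bullet> f x = 0" using cn2(1) c unfolding v2 by (simp add: \<gamma>0)
  have "sin \<theta> * (snd (acceleration \<gamma> 0) \<bullet> f x) = sin \<theta> * (- sin \<theta> * (DF y \<bullet> DF y))"
    using cn2(2) unfolding v2 by (simp add: \<gamma>0)
  then show "snd (acceleration \<gamma> 0) \<bullet> f x = - sin \<theta> * (DF y \<bullet> DF y)"
    by (rule mult_left_cancel[THEN iffD1, rotated]) (use c in simp)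
  define D2 where "D2 b = frechet_derivative (\<lambda>z. frechet_derivative F (at z) b) (at x)" for b
  have "((\<lambda>t. (\<xi>' t \<bullet> b) *\<^sub>R (sin \<theta> *\<^sub>R frechet_derivative F (at (\<xi> t)) b)) has_vector_derivative
      (\<xi>' 0 \<bullet> b) *\<^sub>R (sin \<theta> *\<^sub>R D2 b (\<xi>' 0)) + (\<xi>'' \<bullet> b) *\<^sub>R (sin \<theta> *\<^sub>R DF b)) (at 0)" for b
  proof -
    have "((\<lambda>z. frechet_derivative F (at z) b) has_derivative D2 b) (at (\<xi> 0))"
      unfolding D2_def \<xi>0 by (rule smooth_on_open_has_derivative[OF smooth_on_open_derivative[OF smooth] x(2)])
    from vector_derivative_diff_chain_within[OF \<xi>d[OF I(2)] has_derivative_at_withinI[OF this]]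
    have "((\<lambda>t. frechet_derivative F (at (\<xi> t)) b) has_vector_derivative D2 b (\<xi>' 0)) (at 0)" by (simp add: o_def)
    then have A: "((\<lambda>t. sin \<theta> *\<^sub>R frechet_derivative F (at (\<xi> t)) b) has_vector_derivative sin \<theta> *\<^sub>R D2 b (\<xi>' 0)) (at 0)"
      by (rule bounded_linear.has_vector_derivative[OF bounded_linear_scaleR_right])
    have "((\<lambda>t. \<xi>' t \<bullet> b) has_vector_derivative \<xi>'' \<bullet> b) (at 0)"
      by (rule bounded_linear.has_vector_derivative[OF bounded_linear_inner_left \<xi>d2])
    then have "((\<lambda>t. \<xi>' t \<bullet> b) has_real_derivative \<xi>'' \<bullet> b) (at 0)"
      by (simp add: has_real_derivative_iff_has_vector_derivative)
    from has_vector_derivative_scaleR[OF this A] show ?thesis by (simp add: \<xi>0)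
  qed
  then have "((\<lambda>t. \<Sum>b\<in>Basis. (\<xi>' t \<bullet> b) *\<^sub>R (sin \<theta> *\<^sub>R frechet_derivative F (at (\<xi> t)) b)) has_vector_derivative
      (\<Sum>b\<in>Basis. (\<xi>' 0 \<bullet> b) *\<^sub>R (sin \<theta> *\<^sub>R D2 b (\<xi>' 0)) + (\<xi>'' \<bullet> b) *\<^sub>R (sin \<theta> *\<^sub>R DF b))) (at 0)"
    by (rule has_vector_derivative_sum)
  then have "((\<lambda>t. snd (velocity \<gamma> t)) has_vector_derivative
      (\<Sum>b\<in>Basis. (\<xi>' 0 \<bullet> b) *\<^sub>R (sin \<theta> *\<^sub>R D2 b (\<xi>' 0)) + (\<xi>'' \<bullet> b) *\<^sub>R (sin \<theta> *\<^sub>R DF b))) (at 0)"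
    by (rule has_vector_derivative_transform_within_open[OF _ I]) (simp add: snd_v(1))
  then have "snd (acceleration \<gamma> 0) = (\<Sum>b\<in>Basis. (\<xi>' 0 \<bullet> b) *\<^sub>R (sin \<theta> *\<^sub>R D2 b (\<xi>' 0)) + (\<xi>'' \<bullet> b) *\<^sub>R (sin \<theta> *\<^sub>R DF b))"
    using vector_derivative_unique_at snd_d2 by blast
  also have "\<dots> = sin \<theta> *\<^sub>R ((\<Sum>b\<in>Basis. (\<xi>'' \<bullet> b) *\<^sub>R DF b) + (\<Sum>b\<in>Basis. (\<xi>' 0 \<bullet> b) *\<^sub>R D2 b (\<xi>' 0)))"
    by (simp add: sum.distrib scaleR_sum_right scaleR_add_right mult.commute)
  also have "(\<Sum>b\<in>Basis. (\<xi>'' \<bullet> b) *\<^sub>R DF b) = DF \<xi>''"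
    using linear_DF by (subst (2) euclidean_representation[of "\<xi>''", symmetric]) (simp add: linear_sum linear_cmul)
  finally show "snd (acceleration \<gamma> 0) = sin \<theta> *\<^sub>R (DF ((1 / cos \<theta>) *\<^sub>R fst (acceleration \<gamma> 0)) +
      (\<Sum>b\<in>Basis. (y \<bullet> b) *\<^sub>R frechet_derivative (\<lambda>z. frechet_derivative F (at z) b) (at x) y))"
    by (simp only: \<xi>''_def D2_def y)
qed

end

section \<open>Tangent space, second fundamental form and mean curvature\<close>

context LO_point begin

text \<open>At a unit vector the derivative of \<open>sgn\<close> is the orthogonal projection along
  \<open>x\<close>, which fixes tangent vectors.\<close>

lemma sphere_differential_eq:
  assumes "y \<bullet> x = 0"
  shows "sphere_differential f x y = DF y"
proof -
  have x0: "x \<noteq> 0" "sgn x = x" using x by (auto simp: sgn_div_norm)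
  have nd: "(norm has_derivative (\<lambda>h. h \<bullet> sgn x)) (at x)" using has_derivative_norm[OF x0(1)] by (simp add: inner_commute)
  have "((\<lambda>y. inverse (norm y)) has_derivative (\<lambda>h. - (h \<bullet> x))) (at x)"
    using Deriv.has_derivative_inverse[OF _ nd] x x0 by simp
  from has_derivative_scaleR[OF this has_derivative_ident]
  have sgn_d: "(sgn has_derivative (\<lambda>h. h - (h \<bullet> x) *\<^sub>R x)) (at x)"
    by (simp add: sgn_div_norm[abs_def] x)
  have "open U" using smooth by (simp add: smooth_on_open_def)
  have "continuous_on (- {0}) (sgn :: 'a \<Rightarrow> 'a)" by (intro continuous_intros) auto
  then have V: "open (- {0} \<inter> sgn -` U)" by (rule continuous_open_preimage) (auto intro: \<open>open U\<close>)
  have xV: "x \<in> - {0} \<inter> sgn -` U" using x x0 by auto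
  have "((\<lambda>y. F (sgn y)) has_derivative (\<lambda>h. DF (h - (h \<bullet> x) *\<^sub>R x))) (at x)"
    using diff_chain_at[OF sgn_d, of F DF] smooth_on_open_has_derivative[OF smooth x(2)] x0 by (simp add: o_def)
  then have "((\<lambda>y. f (sgn y)) has_derivative (\<lambda>h. DF (h - (h \<bullet> x) *\<^sub>R x))) (at x)"
    by (rule has_derivative_transform_within_open[OF _ V xV]) (auto simp: extends norm_sgn)
  from fun_cong[OF frechet_derivative_at[OF this], of y] show ?thesis
    using assms by (simp add: sphere_differential_def)
qed

text \<open>Velocities have this form by \<open>curve_velocity\<close>. Conversely, \<open>F\<close>
  lifts a great circle through \<open>x\<close> with velocity \<open>y\<close> to a curve in
  \<open>M\<close>.\<close>

lemma tangent_space_eq: "tangent_space_of M P = J ` {y. y \<bullet> x = 0}"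
proof (intro equalityI subsetI)
  fix v assume "v \<in> tangent_space_of M P"
  then show "v \<in> J ` {y. y \<bullet> x = 0}"
    unfolding tangent_space_of_def using curve_velocity(1,2) by blast
next
  fix v assume "v \<in> J ` {y. y \<bullet> x = 0}"
  then obtain y where y: "v = J y" "y \<bullet> x = 0" by auto
  define a where "a = norm y"
  \<comment> \<open>For \<open>y = 0\<close> the quotient \<open>1 / a\<close> is 0 and
    \<open>g\<close> is constantly \<open>x\<close>.\<close>
  define g where "g t = cos (a * t) *\<^sub>R x + sin (a * t) *\<^sub>R ((1 / a) *\<^sub>R y)" for t
  have "open U" using smooth by (simp add: smooth_on_open_def)
  have "isCont g 0" unfolding g_def by (intro continuous_intros)
  moreover have "g 0 = x" by (simp add: g_def)
  ultimately have "eventually (\<lambda>t. g t \<in> U) (at 0)"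
    using topological_tendstoD[of g x "at 0" U] \<open>open U\<close> x by (simp add: isCont_def)
  then obtain \<epsilon> where \<epsilon>: "\<epsilon> > 0" "\<And>t. t \<noteq> 0 \<Longrightarrow> dist t 0 < \<epsilon> \<Longrightarrow> g t \<in> U"
    unfolding eventually_at by auto
  define I where "I = {-\<epsilon><..<\<epsilon>}"
  have gU: "g t \<in> U" if "t \<in> I" for t
    using \<epsilon>(2)[of t] that x \<open>g 0 = x\<close> by (cases "t = 0") (auto simp: I_def dist_real_def)
  have gn: "norm (g t) = 1" for t
  proof -
    have "g t \<bullet> g t = (cos (a * t))\<^sup>2 * (x \<bullet> x) + (sin (a * t))\<^sup>2 * ((1 / a)\<^sup>2 * (y \<bullet> y))"
      using y(2) by (simp add: g_def inner_add_left inner_add_right inner_commute power2_eq_square algebra_simps)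
    also have "\<dots> = 1"
      using x by (cases "y = 0") (simp_all add: a_def dot_square_norm power_divide)
    finally show ?thesis by (simp add: norm_eq_1)
  qed
  have gs: "smooth_on_open I g" unfolding g_def by (rule smooth_on_open_great_circle) (simp add: I_def)
  have Fs: "smooth_on_open I (\<lambda>t. F (g t))" using gU by (intro smooth_on_open_compose_curve[OF gs smooth]) auto
  define \<gamma> where "\<gamma> t = (cos \<theta> *\<^sub>R g t, sin \<theta> *\<^sub>R F (g t))" for t
  have "smooth_on_open I (\<lambda>t. (cos \<theta> *\<^sub>R g t, 0 :: 'b) + (0 :: 'a, sin \<theta> *\<^sub>R F (g t)))"
    by (intro smooth_on_open_add smooth_on_open_linear[OF gs] smooth_on_open_linear[OF Fs]
        bounded_linear_Pair bounded_linear_zero bounded_linear_scaleR_right)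
  then have \<gamma>s: "smooth_on_open I \<gamma>" by (simp add: \<gamma>_def[abs_def])
  have "\<gamma> ` I \<subseteq> M"
    using gU gn extends by (auto simp: \<gamma>_def LO_submanifold_def intro!: image_eqI)
  moreover have "\<gamma> 0 = P" using x extends by (simp add: \<gamma>_def \<open>g 0 = x\<close>)
  ultimately have curve: "curve_through M P \<gamma>"
    unfolding curve_through_def using \<epsilon>(1) \<gamma>s by (auto simp: I_def)
  \<comment> \<open>The first component determines a velocity, which is of the form
    \<open>J y\<close>; so only that component is computed.\<close>
  have "(g has_vector_derivative a *\<^sub>R ((1 / a) *\<^sub>R y)) (at 0)"
    unfolding g_def has_vector_derivative_def by (auto intro!: derivative_eq_intros)
  then have "(g has_vector_derivative y) (at 0)" by (cases "y = 0") (simp_all add: a_def)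
  then have "((\<lambda>t. cos \<theta> *\<^sub>R g t) has_vector_derivative cos \<theta> *\<^sub>R y) (at 0)"
    by (rule bounded_linear.has_vector_derivative[OF bounded_linear_scaleR_right])
  moreover have "0 \<in> I" using \<epsilon>(1) by (simp add: I_def)
  then have "((\<lambda>t. fst (\<gamma> t)) has_vector_derivative fst (velocity \<gamma> 0)) (at 0)"
    using smooth_curve_has_vector_derivative(1)[OF \<gamma>s]
    by (auto intro: bounded_linear.has_vector_derivative bounded_linear_fst)
  ultimately have "fst (velocity \<gamma> 0) = cos \<theta> *\<^sub>R y"
    using vector_derivative_unique_at by (auto simp: \<gamma>_def)
  then have "velocity \<gamma> 0 = J y" using curve_velocity(1)[OF curve] cos_sin_pos by simp
  then show "v \<in> tangent_space_of M P" using curve unfolding y(1) tangent_space_of_def by force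
qed

lemma DF_orthogonal_f: "y \<bullet> x = 0 \<Longrightarrow> DF y \<bullet> f x = 0"
proof -
  assume y: "y \<bullet> x = 0"
  then have "J y \<in> tangent_space_of M P" using tangent_space_eq by auto
  then obtain \<gamma> where "curve_through M P \<gamma>" "velocity \<gamma> 0 = J y" unfolding tangent_space_of_def by force
  then show ?thesis using curve_velocity(3)[of \<gamma>] cos_sin_pos by (simp add: J_def)
qed

text \<open>In the formulas for the acceleration, the terms quadratic in the velocity cancel, and
  the graph equation turns the difference into a value of \<open>J\<close>. This makes the second
  fundamental form well defined.\<close>

lemma acceleration_difference_tangent:
  assumes "curve_through M P \<gamma>" "curve_through M P \<gamma>'" "velocity \<gamma> 0 = velocity \<gamma>' 0"
  shows "acceleration \<gamma> 0 - acceleration \<gamma>' 0 \<in> tangent_space_of M P"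
proof -
  define y where "y = (1 / cos \<theta>) *\<^sub>R (fst (acceleration \<gamma> 0) - fst (acceleration \<gamma>' 0))"
  note c = cos_sin_pos
  have "y \<bullet> x = 0"
    using curve_velocity(4)[OF assms(1)] curve_velocity(4)[OF assms(2)] assms(3)
    by (simp add: y_def inner_diff_left)
  moreover have "acceleration \<gamma> 0 - acceleration \<gamma>' 0 = J y"
    using curve_velocity(6)[OF assms(1)] curve_velocity(6)[OF assms(2)] assms(3) c linear_DF
    by (simp add: prod_eq_iff J_def y_def linear_diff scaleR_diff_right scaleR_add_right linear_cmul)
  ultimately show ?thesis using tangent_space_eq by auto
qed

text \<open>The normal projection of the acceleration satisfies the definite description. Any other
  candidate differs from it by a normal vector \<open>d\<close>, and
  \<open>d \<bullet> d = 0\<close> because accelerations with equal velocity differ by a tangent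
  vector.\<close>

lemma second_fundamental_form_inner:
  assumes \<gamma>: "curve_through M P \<gamma>" and \<nu>: "\<nu> \<in> sphere_normal_space M P"
  shows "second_fundamental_form M P (velocity \<gamma> 0) \<bullet> \<nu> = acceleration \<gamma> 0 \<bullet> \<nu>"
proof -
  define N where "N = sphere_normal_space M P"
  have N: "subspace N"
    unfolding N_def sphere_normal_space_def subspace_def by (auto simp: inner_add_left)
  define p where "p w \<longleftrightarrow> w \<in> N \<and> (\<exists>\<gamma>'. curve_through M P \<gamma>' \<and> velocity \<gamma>' 0 = velocity \<gamma> 0 \<and>
           (\<forall>\<nu>\<in>N. (acceleration \<gamma>' 0 - w) \<bullet> \<nu> = 0))" for w
  obtain w z where w: "w \<in> span N" "\<And>u. u \<in> span N \<Longrightarrow> orthogonal z u" "acceleration \<gamma> 0 = w + z"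
    using orthogonal_subspace_decomp_exists[of N "acceleration \<gamma> 0"] by metis
  moreover have "span N = N" using N by (simp add: span_eq_iff)
  ultimately have wN: "w \<in> N" "\<And>u. u \<in> N \<Longrightarrow> z \<bullet> u = 0"
    by (simp_all add: orthogonal_def)
  then have "p w" unfolding p_def using \<gamma> w(3) by (auto intro!: exI[of _ \<gamma>])
  moreover have "w' = w" if w': "p w'" for w'
  proof -
    obtain \<gamma>' where \<gamma>': "curve_through M P \<gamma>'" "velocity \<gamma>' 0 = velocity \<gamma> 0"
      "\<forall>\<nu>\<in>N. (acceleration \<gamma>' 0 - w') \<bullet> \<nu> = 0" and "w' \<in> N" using w' unfolding p_def by blast
    define d where "d = w' - w"
    have d: "d \<in> N" unfolding d_def using N \<open>w' \<in> N\<close> wN(1) by (rule subspace_diff)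
    have "d \<bullet> (acceleration \<gamma>' 0 - acceleration \<gamma> 0) = 0"
      using acceleration_difference_tangent[OF \<gamma>'(1) \<gamma> \<gamma>'(2)] d unfolding N_def sphere_normal_space_def by blast
    moreover have "(acceleration \<gamma>' 0 - w') \<bullet> d = 0" "z \<bullet> d = 0" using \<gamma>'(3) wN(2) d by auto
    ultimately have "d \<bullet> d = 0"
      unfolding w(3) by (simp add: d_def inner_diff_left inner_diff_right inner_add_right inner_add_left inner_commute)
    then show ?thesis by (simp add: d_def)
  qed
  ultimately have "(THE w. p w) = w" by blast
  then have "second_fundamental_form M P (velocity \<gamma> 0) = w"
    unfolding second_fundamental_form_def p_def N_def .
  then show ?thesis using wN(2)[of \<nu>] \<nu> by (simp add: w(3) inner_add_left N_def)
qed

text \<open>The mean curvature is paired with one normal, built from \<open>x\<close> and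
  \<open>f x\<close>. The acceleration components along these two vectors are fixed by the velocity,
  so no second derivative of \<open>f\<close> survives.\<close>

lemma minimal_trace:
  assumes min: "minimal_submanifold_of_sphere d M"
    and B: "orthonormal_basis_of (J ` {y. y \<bullet> x = 0}) B"
  shows "(\<Sum>v\<in>B. sin \<theta> / cos \<theta> * (fst v \<bullet> fst v) - cos \<theta> / sin \<theta> * (snd v \<bullet> snd v)) = 0"
proof -
  note c = cos_sin_pos
  define \<nu> where "\<nu> = (- sin \<theta> *\<^sub>R x, cos \<theta> *\<^sub>R f x)"
  have \<nu>: "\<nu> \<in> sphere_normal_space M P"
    unfolding sphere_normal_space_def tangent_space_eq
    using x norm_f[OF x(1)] DF_orthogonal_f
    by (auto simp: \<nu>_def J_def norm_eq_1 inner_commute)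
  have "P \<in> M" using x by (auto simp: LO_submanifold_def)
  then have "(\<Sum>v\<in>B. second_fundamental_form M P v) = 0"
    using min B unfolding minimal_submanifold_of_sphere_def tangent_space_eq[symmetric] by blast
  then have "(\<Sum>v\<in>B. second_fundamental_form M P v \<bullet> \<nu>) = 0"
    by (metis inner_sum_left inner_zero_left)
  moreover have "second_fundamental_form M P v \<bullet> \<nu>
      = sin \<theta> / cos \<theta> * (fst v \<bullet> fst v) - cos \<theta> / sin \<theta> * (snd v \<bullet> snd v)" if "v \<in> B" for v
  proof -
    have "v \<in> tangent_space_of M P" using that B unfolding orthonormal_basis_of_def tangent_space_eq by blast
    then obtain \<gamma> where \<gamma>: "curve_through M P \<gamma>" "v = velocity \<gamma> 0" unfolding tangent_space_of_def by blast
    define y where "y = (1 / cos \<theta>) *\<^sub>R fst (velocity \<gamma> 0)"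
    note cv = curve_velocity[OF \<gamma>(1), folded y_def]
    have "second_fundamental_form M P v \<bullet> \<nu> = acceleration \<gamma> 0 \<bullet> \<nu>"
      unfolding \<gamma>(2) by (rule second_fundamental_form_inner[OF \<gamma>(1) \<nu>])
    also have "\<dots> = - sin \<theta> * (fst (acceleration \<gamma> 0) \<bullet> x) + cos \<theta> * (snd (acceleration \<gamma> 0) \<bullet> f x)"
      by (cases "acceleration \<gamma> 0") (simp add: \<nu>_def)
    also have "\<dots> = sin \<theta> / cos \<theta> * (fst v \<bullet> fst v) - cos \<theta> / sin \<theta> * (snd v \<bullet> snd v)"
      using c unfolding cv(4,5) \<gamma>(2) cv(1) by (simp add: J_def)
    finally show ?thesis .
  qed
  ultimately show ?thesis by simp
qed

end

section \<open>Singular spaces and the angle\<close>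

text \<open>A spectral theorem by the Rayleigh quotient. If the complement \<open>W\<close> of both
  eigenspaces in \<open>T\<close> were nonzero, a unit vector of \<open>W\<close> with image of
  maximal norm would be an eigenvector for a value excluded by \<open>eigen\<close> or would lie in
  an eigenspace orthogonal to itself.\<close>

lemma singular_subspaces_span:
  fixes D :: "'a::euclidean_space \<Rightarrow> 'b::real_inner" and T :: "'a set" and lam :: real
  assumes D: "linear D" and T: "subspace T"
  defines "V \<equiv> \<lambda>s. {v\<in>T. \<forall>w\<in>T. D v \<bullet> D w = s\<^sup>2 * (v \<bullet> w)}"
  assumes eigen: "\<And>s. 0 \<le> s \<Longrightarrow> \<exists>v\<in>V s. v \<noteq> 0 \<Longrightarrow> s = 0 \<or> s = lam"
  shows "T \<subseteq> span (V 0 \<union> V lam)"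
proof -
  define W where "W = {w\<in>T. \<forall>v\<in>V 0 \<union> V lam. v \<bullet> w = 0}"
  have W: "subspace W"
    using T unfolding W_def subspace_def by (auto simp: inner_add_right)
  have V_T: "V 0 \<union> V lam \<subseteq> T" by (auto simp: V_def)
  have orth: "v \<bullet> w = 0" if "v \<in> span (V 0 \<union> V lam)" "w \<in> W" for v w
    using orthogonal_to_span[OF that(1), of w] that(2) by (simp add: W_def orthogonal_def inner_commute)
  have decomp: "\<exists>y\<in>span (V 0 \<union> V lam). \<exists>z\<in>W. t = y + z" if t: "t \<in> T" for t
  proof -
    obtain y z where yz: "y \<in> span (V 0 \<union> V lam)"
        "\<And>w. w \<in> span (V 0 \<union> V lam) \<Longrightarrow> orthogonal z w" "t = y + z"
      using orthogonal_subspace_decomp_exists[of "V 0 \<union> V lam" t] by metis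
    have "y \<in> T" using yz(1) span_minimal[OF V_T T] by blast
    then have "z \<in> T" using subspace_diff[OF T t] yz(3) by (metis add_diff_cancel_left')
    then have "z \<in> W" using yz(2)[OF span_base] unfolding W_def by (auto simp: orthogonal_def inner_commute)
    then show ?thesis using yz by blast
  qed
  have "W \<subseteq> {0}"
  proof (rule ccontr)
    assume "\<not> W \<subseteq> {0}"
    then obtain w0 where w0: "w0 \<in> W" "w0 \<noteq> 0" by blast
    define K where "K = W \<inter> sphere 0 1"
    have K: "compact K" unfolding K_def using closed_subspace[OF W] by (simp add: closed_Int_compact)
    have "sgn w0 \<in> K"
      using w0 W by (auto simp: K_def norm_sgn sgn_div_norm subspace_scale)
    then have K': "K \<noteq> {}" by blast
    have "continuous_on K (\<lambda>v. D v \<bullet> D v)"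
      by (intro continuous_on_inner linear_continuous_on linear_conv_bounded_linear[THEN iffD1] D)
    from continuous_attains_sup[OF K K' this]
    obtain v0 where v0: "v0 \<in> K" "\<And>v. v \<in> K \<Longrightarrow> D v \<bullet> D v \<le> D v0 \<bullet> D v0" by blast
    define \<mu> where "\<mu> = D v0 \<bullet> D v0"
    have \<mu>: "\<mu> \<ge> 0" by (simp add: \<mu>_def)
    have v0': "v0 \<in> W" "v0 \<bullet> v0 = 1" "v0 \<in> T" using v0(1) by (auto simp: K_def W_def norm_eq_1)
    have le: "D w \<bullet> D w \<le> \<mu> * (w \<bullet> w)" if w: "w \<in> W" for w
    proof (cases "w = 0")
      case False
      have "sgn w \<in> K" using w W False by (auto simp: K_def norm_sgn sgn_div_norm subspace_scale)
      then have "D (sgn w) \<bullet> D (sgn w) \<le> \<mu>" using v0(2) by (simp add: \<mu>_def)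
      then have "(D w \<bullet> D w) / (norm w)\<^sup>2 \<le> \<mu>"
        using D by (simp add: sgn_div_norm linear_cmul power2_eq_square divide_inverse mult_ac)
      then show ?thesis using False by (simp add: divide_le_eq dot_square_norm)
    qed (simp add: linear_0[OF D])
    \<comment> \<open>First variation at the maximiser: \<open>quad\<close> is the bound
      \<open>le\<close> at \<open>v0 + e *\<^sub>R w\<close>, and it forces the linear coefficient
      to vanish.\<close>
    have crit: "D v0 \<bullet> D w = \<mu> * (v0 \<bullet> w)" if w: "w \<in> W" for w
    proof -
      define b where "b = \<mu> * (v0 \<bullet> w) - D v0 \<bullet> D w"
      define c where "c = \<mu> * (w \<bullet> w) - D w \<bullet> D w"
      have c: "c \<ge> 0" using le[OF w] by (simp add: c_def)
      have quad: "0 \<le> 2 * e * b + e\<^sup>2 * c" for e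
      proof -
        have "v0 + e *\<^sub>R w \<in> W" using v0' w W by (intro subspace_add subspace_scale)
        from le[OF this] show ?thesis
          using D v0'(2) by (simp add: linear_add linear_cmul inner_add_left inner_add_right b_def c_def
            \<mu>_def[symmetric] inner_commute algebra_simps power2_eq_square)
      qed
      have "b = 0"
      proof (rule ccontr)
        assume b: "b \<noteq> 0"
        \<comment> \<open>The denominator \<open>c + 1\<close> keeps the test value meaningful when
          \<open>c = 0\<close>.\<close>
        have "2 * (- b / (c + 1)) * b + (- b / (c + 1))\<^sup>2 * c = - (b\<^sup>2 * (c + 2) / (c + 1)\<^sup>2)"
          using c by (simp add: divide_simps power2_eq_square) (simp add: algebra_simps)
        moreover have "b\<^sup>2 * (c + 2) / (c + 1)\<^sup>2 > 0" using b c by simp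
        ultimately show False using quad[of "- b / (c + 1)"] by simp
      qed
      then show ?thesis by (simp add: b_def)
    qed
    \<comment> \<open>The part of \<open>t\<close> in the span of the eigenspaces contributes 0 on
      both sides, since the equation defining an eigenvector can be tested with
      \<open>v0\<close>.\<close>
    have eig: "D v0 \<bullet> D t = \<mu> * (v0 \<bullet> t)" if t: "t \<in> T" for t
    proof -
      obtain y z where yz: "y \<in> span (V 0 \<union> V lam)" "z \<in> W" "t = y + z" using decomp[OF t] by blast
      have "D v \<bullet> D v0 = 0" if v: "v \<in> V 0 \<union> V lam" for v
        using v v0' orth[OF span_base[OF v] v0'(1)] by (auto simp: V_def)
      then have "\<forall>v\<in>V 0 \<union> V lam. orthogonal (D v0) (D v)" by (simp add: orthogonal_def inner_commute)
      then have "orthogonal (D v0) (D y)"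
        using yz(1) orthogonal_to_span[of "D y" "D ` (V 0 \<union> V lam)" "D v0"] linear_span_image[OF D] by auto
      moreover have "y \<bullet> v0 = 0" using orth[OF yz(1) v0'(1)] .
      ultimately show ?thesis using crit[OF yz(2)] D yz(3)
        by (simp add: linear_add inner_add_right orthogonal_def inner_commute)
    qed
    then have "v0 \<in> V (sqrt \<mu>)" using v0' \<mu> by (simp add: V_def)
    moreover have "v0 \<noteq> 0" using v0'(2) by auto
    ultimately have "sqrt \<mu> = 0 \<or> sqrt \<mu> = lam" using eigen[of "sqrt \<mu>"] \<mu> by auto
    then have "v0 \<in> V 0 \<union> V lam" using \<open>v0 \<in> V (sqrt \<mu>)\<close> by auto
    then show False using v0' by (auto simp: W_def)
  qed
  then show ?thesis using decomp by force
qed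

context LO_point begin

text \<open>Orthonormal bases of the kernel and of the other singular space. They are mutually
  orthogonal, as for distinct eigenvalues, and span the tangent space because there are no further
  singular values.\<close>

lemma adapted_basis:
  assumes sv: "singular_values f x = {0, lam}" and lam: "0 < lam"
  obtains B0 B1 where "finite B0" "finite B1" "B0 \<inter> B1 = {}" "pairwise orthogonal (B0 \<union> B1)"
    "\<forall>v\<in>B0 \<union> B1. norm v = 1" "span (B0 \<union> B1) = {y. y \<bullet> x = 0}"
    "card B1 = dim (singular_space f x lam)" "card B0 + card B1 + 1 = DIM('a)" "B0 \<noteq> {}" "B1 \<noteq> {}"
    "\<forall>v\<in>B0. DF v = 0" "\<forall>v\<in>B1. \<forall>w\<in>B1. DF v \<bullet> DF w = lam\<^sup>2 * (v \<bullet> w)"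
proof -
  define T where "T = {y. y \<bullet> x = 0}"
  have T: "subspace T" unfolding T_def subspace_def by (auto simp: inner_add_left)
  define V where "V s = {v\<in>T. \<forall>w\<in>T. DF v \<bullet> DF w = s\<^sup>2 * (v \<bullet> w)}" for s
  have V: "V s = singular_space f x s" for s
    by (auto simp: V_def T_def singular_space_def sphere_differential_eq)
  have sub: "subspace (V s)" for s
    using T linear_DF unfolding V_def subspace_def
    by (auto simp: linear_add linear_cmul linear_0 inner_add_left algebra_simps)
  have ex: "\<exists>v\<in>V 0. v \<noteq> 0" "\<exists>v\<in>V lam. v \<noteq> 0" using sv lam unfolding V singular_values_def by auto
  have spanT: "T \<subseteq> span (V 0 \<union> V lam)"
    unfolding V_def
  proof (rule singular_subspaces_span[OF linear_DF T], fold V_def)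
    fix s :: real assume "0 \<le> s" "\<exists>v\<in>V s. v \<noteq> 0"
    then have "s \<in> singular_values f x" unfolding singular_values_def V by auto
    then show "s = 0 \<or> s = lam" using sv by auto
  qed
  obtain B0 where B0: "B0 \<subseteq> V 0" "pairwise orthogonal B0" "\<And>v. v \<in> B0 \<Longrightarrow> norm v = 1"
      "independent B0" "card B0 = dim (V 0)" "span B0 = V 0"
    using orthonormal_basis_subspace[OF sub[of 0]] by metis
  obtain B1 where B1: "B1 \<subseteq> V lam" "pairwise orthogonal B1" "\<And>v. v \<in> B1 \<Longrightarrow> norm v = 1"
      "independent B1" "card B1 = dim (V lam)" "span B1 = V lam"
    using orthonormal_basis_subspace[OF sub[of lam]] by metis
  have DF0: "DF v = 0" if "v \<in> B0" for v
  proof -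
    have "v \<in> V 0" using that B0(1) by blast
    then have "DF v \<bullet> DF v = 0\<^sup>2 * (v \<bullet> v)" unfolding V_def by blast
    then show ?thesis by simp
  qed
  have DF1: "DF v \<bullet> DF w = lam\<^sup>2 * (v \<bullet> w)" if "v \<in> B1" "w \<in> B1" for v w
    using that B1(1) by (auto simp: V_def)
  have cross: "orthogonal v w" if "v \<in> B0" "w \<in> B1" for v w
  proof -
    have "DF w \<bullet> DF v = lam\<^sup>2 * (w \<bullet> v)" using that B0(1) B1(1) by (auto simp: V_def)
    then show ?thesis using DF0[OF that(1)] lam by (simp add: orthogonal_def inner_commute)
  qed
  have po: "pairwise orthogonal (B0 \<union> B1)"
    using B0(2) B1(2) cross orthogonal_commute unfolding pairwise_def by blast
  have n1: "norm v = 1" if "v \<in> B0 \<union> B1" for v using that B0(3) B1(3) by auto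
  then have "0 \<notin> B0 \<union> B1" by force
  then have ind: "independent (B0 \<union> B1)" using pairwise_orthogonal_independent[OF po] by blast
  have disj: "B0 \<inter> B1 = {}" using cross n1 by (fastforce simp: orthogonal_self)
  have fin: "finite B0" "finite B1" using B0(4) B1(4) independent_imp_finite by auto
  have span: "span (B0 \<union> B1) = T"
  proof
    show "span (B0 \<union> B1) \<subseteq> T" using B0(1) B1(1) T by (intro span_minimal) (auto simp: V_def)
    have "V 0 \<union> V lam \<subseteq> span (B0 \<union> B1)"
      using B0(6) B1(6) span_mono[of B0 "B0 \<union> B1"] span_mono[of B1 "B0 \<union> B1"] by auto
    then have "span (V 0 \<union> V lam) \<subseteq> span (B0 \<union> B1)" by (intro span_minimal subspace_span)
    then show "T \<subseteq> span (B0 \<union> B1)" using spanT by blast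
  qed
  have "card B0 + card B1 = card (B0 \<union> B1)" using fin disj by (simp add: card_Un_disjoint)
  also have "\<dots> = dim T" unfolding span[symmetric] dim_span using ind by (rule dim_eq_card_independent[symmetric])
  also have "\<dots> = DIM('a) - 1"
  proof -
    have "x \<noteq> 0" using x by auto
    from dim_hyperplane[OF this] show ?thesis unfolding T_def by (simp add: inner_commute)
  qed
  finally have card: "card B0 + card B1 + 1 = DIM('a)" by simp
  have ne: "B0 \<noteq> {}" "B1 \<noteq> {}" using ex B0(6) B1(6) by auto
  show ?thesis
    by (rule that[OF fin disj po _ span[unfolded T_def] B1(5)[unfolded V] card ne]) (use n1 DF0 DF1 in blast)+
qed

text \<open>This is \<open>minimal_trace\<close> for the normalised image of an adapted basis under
  \<open>J\<close>. The relation is \<open>tan^2 \<theta> = (p - n / lam^2) / (n - p)\<close>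
  cleared of denominators.\<close>

lemma angle_relation:
  assumes min: "minimal_submanifold_of_sphere d M"
    and sv: "singular_values f x = {0, lam}" and lam: "0 < lam"
    and n: "DIM('a) = n + 1" and p: "p = dim (singular_space f x lam)"
  shows "0 < p" "p < n" "p * lam\<^sup>2 * (1 + (tan \<theta>)\<^sup>2) = n * (1 + lam\<^sup>2 * (tan \<theta>)\<^sup>2)"
proof -
  note c = cos_sin_pos
  obtain B0 B1 where B: "finite B0" "finite B1" "B0 \<inter> B1 = {}" "pairwise orthogonal (B0 \<union> B1)"
    "\<forall>v\<in>B0 \<union> B1. norm v = 1" "span (B0 \<union> B1) = {y. y \<bullet> x = 0}"
    "card B1 = p" "card B0 + card B1 + 1 = DIM('a)" "B0 \<noteq> {}" "B1 \<noteq> {}"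
    "\<forall>v\<in>B0. DF v = 0" "\<forall>v\<in>B1. \<forall>w\<in>B1. DF v \<bullet> DF w = lam\<^sup>2 * (v \<bullet> w)"
    by (rule adapted_basis[OF sv lam, folded p]) blast
  have pos: "card B0 > 0" "card B1 > 0" using B by (auto simp: card_gt_0_iff)
  show "0 < p" "p < n" using pos B(7,8) n by auto
  have q: "real (card B0) = n - real p" using B(7,8) n by simp
  \<comment> \<open>The squared norm of \<open>J v\<close> for \<open>v\<close> in
    \<open>B1\<close>; on \<open>B0\<close> it is \<open>(cos \<theta>)\<^sup>2\<close>.\<close>
  define k where "k = (cos \<theta>)\<^sup>2 + (sin \<theta>)\<^sup>2 * lam\<^sup>2"
  have k: "k > 0" using c by (simp add: k_def add_pos_nonneg)
  have J: "J v \<bullet> J w = (cos \<theta>)\<^sup>2 * (v \<bullet> w) + (sin \<theta>)\<^sup>2 * (DF v \<bullet> DF w)" for v w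
    by (simp add: J_def power2_eq_square)
  have J_orth: "J v \<bullet> J w = 0" if "v \<in> B0 \<union> B1" "w \<in> B0 \<union> B1" "v \<noteq> w" for v w
  proof -
    have "v \<bullet> w = 0" using B(4) that by (auto simp: pairwise_def orthogonal_def)
    moreover have "DF v \<bullet> DF w = 0" using that B(11,12) \<open>v \<bullet> w = 0\<close> by auto
    ultimately show ?thesis by (simp add: J)
  qed
  have J0: "J v \<bullet> J v = (cos \<theta>)\<^sup>2" if "v \<in> B0" for v using B(5) B(11) that by (simp add: J norm_eq_1)
  have J1: "J v \<bullet> J v = k" if "v \<in> B1" for v using B(5) B(12) that by (simp add: J norm_eq_1 k_def)
  have Jn: "norm (J v) > 0" if "v \<in> B0 \<union> B1" for v using that J0[of v] J1[of v] c k by auto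
  define j where "j v = (1 / norm (J v)) *\<^sub>R J v" for v
  have jn: "norm (j v) = 1" if "v \<in> B0 \<union> B1" for v using Jn[OF that] by (simp add: j_def)
  have jo: "orthogonal (j v) (j w)" if "v \<in> B0 \<union> B1" "w \<in> B0 \<union> B1" "v \<noteq> w" for v w
    using J_orth[OF that] by (simp add: j_def orthogonal_def)
  have inj: "inj_on j (B0 \<union> B1)"
  proof (rule inj_onI, rule ccontr)
    fix v w assume vw: "v \<in> B0 \<union> B1" "w \<in> B0 \<union> B1" "j v = j w" "v \<noteq> w"
    then have "j v = 0" using jo[OF vw(1,2,4)] by (simp add: orthogonal_self)
    then show False using jn[OF vw(1)] by simp
  qed
  have "orthonormal_basis_of (J ` {y. y \<bullet> x = 0}) (j ` (B0 \<union> B1))"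
    unfolding orthonormal_basis_of_def
  proof (intro conjI ballI)
    have sp: "J ` {y. y \<bullet> x = 0} = span (J ` (B0 \<union> B1))"
      unfolding B(6)[symmetric] linear_span_image[OF linear_J] ..
    have 1: "j ` (B0 \<union> B1) \<subseteq> span (J ` (B0 \<union> B1))" 
      unfolding j_def by (intro image_subsetI span_scale span_base imageI)
    then show "j ` (B0 \<union> B1) \<subseteq> J ` {y. y \<bullet> x = 0}" unfolding sp .
    have "J v \<in> span (j ` (B0 \<union> B1))" if "v \<in> B0 \<union> B1" for v
    proof -
      have "J v = norm (J v) *\<^sub>R j v" using Jn[OF that] by (simp add: j_def)
      then show ?thesis using that by (metis imageI span_base span_scale)
    qed
    then have "span (J ` (B0 \<union> B1)) \<subseteq> span (j ` (B0 \<union> B1))" by (intro span_minimal) auto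
    moreover have "span (j ` (B0 \<union> B1)) \<subseteq> span (J ` (B0 \<union> B1))" using 1 by (intro span_minimal) auto
    ultimately show "span (j ` (B0 \<union> B1)) = J ` {y. y \<bullet> x = 0}" unfolding sp by blast
    show "pairwise orthogonal (j ` (B0 \<union> B1))" unfolding pairwise_def
      by (intro ballI impI, elim imageE) (metis jo)
    show "norm v = 1" if "v \<in> j ` (B0 \<union> B1)" for v using that jn by auto
  qed
  from minimal_trace[OF min this]
  have "0 = (\<Sum>v\<in>B0 \<union> B1. sin \<theta> / cos \<theta> * (fst (j v) \<bullet> fst (j v)) - cos \<theta> / sin \<theta> * (snd (j v) \<bullet> snd (j v)))"
    by (simp add: sum.reindex[OF inj])
  also have "\<dots> = (\<Sum>v\<in>B0. sin \<theta> / cos \<theta>) + (\<Sum>v\<in>B1. sin \<theta> * cos \<theta> * (1 - lam\<^sup>2) / k)"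
    unfolding sum.union_disjoint[OF B(1-3)]
  proof (intro arg_cong2[where f = plus] sum.cong refl)
    have fj: "fst (j v) \<bullet> fst (j v) = (cos \<theta>)\<^sup>2 * (v \<bullet> v) / (J v \<bullet> J v)"
      "snd (j v) \<bullet> snd (j v) = (sin \<theta>)\<^sup>2 * (DF v \<bullet> DF v) / (J v \<bullet> J v)" for v
      by (simp_all add: j_def J_def[of v, symmetric] power2_eq_square power2_norm_eq_inner[symmetric])
         (simp_all add: J_def power2_eq_square)
    fix v
    show "sin \<theta> / cos \<theta> * (fst (j v) \<bullet> fst (j v)) - cos \<theta> / sin \<theta> * (snd (j v) \<bullet> snd (j v)) = sin \<theta> / cos \<theta>"
      if "v \<in> B0"
      unfolding fj J0[OF that] using B(5) B(11) that c by (simp add: norm_eq_1)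
    show "sin \<theta> / cos \<theta> * (fst (j v) \<bullet> fst (j v)) - cos \<theta> / sin \<theta> * (snd (j v) \<bullet> snd (j v))
        = sin \<theta> * cos \<theta> * (1 - lam\<^sup>2) / k"
      if "v \<in> B1"
    proof -
      have "DF v \<bullet> DF v = lam\<^sup>2" "v \<bullet> v = 1" using B(5,12) that by (auto simp: norm_eq_1)
      then show ?thesis unfolding fj J1[OF that] using c k by (simp add: field_simps power2_eq_square)
    qed
  qed
  also have "\<dots> = (n - real p) * (sin \<theta> / cos \<theta>) + p * (sin \<theta> * cos \<theta> * (1 - lam\<^sup>2) / k)"
    by (simp add: q B(7))
  finally have 0: "(n - real p) * (sin \<theta> / cos \<theta>) + p * (sin \<theta> * cos \<theta> * (1 - lam\<^sup>2) / k) = 0" by simp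
  have kt: "k = (cos \<theta>)\<^sup>2 * (1 + lam\<^sup>2 * (tan \<theta>)\<^sup>2)" using c by (simp add: k_def tan_def field_simps)
  have "0 = ((n - real p) * (sin \<theta> / cos \<theta>) + p * (sin \<theta> * cos \<theta> * (1 - lam\<^sup>2) / k)) * (k / (sin \<theta> * cos \<theta>))"
    unfolding 0 by simp
  also have "\<dots> = (n - real p) * k / (cos \<theta>)\<^sup>2 + p * (1 - lam\<^sup>2)"
    using c k by (simp add: field_simps power2_eq_square)
  also have "\<dots> = (n - real p) * (1 + lam\<^sup>2 * (tan \<theta>)\<^sup>2) + p * (1 - lam\<^sup>2)"
    unfolding kt using c by simp
  finally show "p * lam\<^sup>2 * (1 + (tan \<theta>)\<^sup>2) = n * (1 + lam\<^sup>2 * (tan \<theta>)\<^sup>2)" by (simp add: algebra_simps)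
qed

end

section \<open>Spherical harmonics\<close>

text \<open>Directional derivatives of polynomials are polynomials, so smoothness will follow by
  iteration.\<close>

lemma real_polynomial_function_derivative:
  fixes P :: "'a::euclidean_space \<Rightarrow> real"
  assumes "real_polynomial_function P"
  shows "\<exists>P'. (\<forall>y. (P has_derivative P' y) (at y)) \<and> (\<forall>v. real_polynomial_function (\<lambda>y. P' y v))"
  using assms
proof induction
  case (linear h)
  then show ?case
    by (intro exI[of _ "\<lambda>y. h"]) (auto intro: bounded_linear_imp_has_derivative real_polynomial_function.intros)
next
  case (const c)
  show ?case by (intro exI[of _ "\<lambda>y v. 0"]) (auto intro: real_polynomial_function.intros)
next
  case (add g h)
  then obtain g' h' where "\<forall>y. (g has_derivative g' y) (at y)" "\<forall>v. real_polynomial_function (\<lambda>y. g' y v)"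
    "\<forall>y. (h has_derivative h' y) (at y)" "\<forall>v. real_polynomial_function (\<lambda>y. h' y v)" by blast
  then show ?case
    by (intro exI[of _ "\<lambda>y v. g' y v + h' y v"]) (auto intro: has_derivative_add real_polynomial_function.intros)
next
  case (mult g h)
  then obtain g' h' where d: "\<And>y. (g has_derivative g' y) (at y)" "\<And>v. real_polynomial_function (\<lambda>y. g' y v)"
    "\<And>y. (h has_derivative h' y) (at y)" "\<And>v. real_polynomial_function (\<lambda>y. h' y v)" by blast
  have "real_polynomial_function (\<lambda>y. g y * h' y v + g' y v * h y)" for v
    using mult d by (intro real_polynomial_function.intros(3,4))
  moreover have "((\<lambda>y. g y * h y) has_derivative (\<lambda>v. g y * h' y v + g' y v * h y)) (at y)" for y
    using d by (intro has_derivative_mult)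
  ultimately show ?case by (intro exI[of _ "\<lambda>y v. g y * h' y v + g' y v * h y"]) auto
qed

lemma smooth_on_open_real_polynomial_function:
  fixes P :: "'a::euclidean_space \<Rightarrow> real"
  assumes "real_polynomial_function P"
  shows "smooth_on_open UNIV P"
proof -
  have "Ck_on k UNIV P" for k
    using assms
  proof (induction k arbitrary: P)
    case 0
    then obtain P' where "\<forall>y. (P has_derivative P' y) (at y)"
      using real_polynomial_function_derivative by blast
    then have "isCont P y" for y using has_derivative_continuous by blast
    then show ?case by (auto intro: continuous_at_imp_continuous_on)
  next
    case (Suc k)
    obtain P' where P': "\<forall>y. (P has_derivative P' y) (at y)" "\<forall>v. real_polynomial_function (\<lambda>y. P' y v)"
      using real_polynomial_function_derivative[OF Suc.prems] by blast
    show ?case by (rule Ck_on_SucI[where F' = P']) (use P' Suc.IH in auto)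
  qed
  then show ?thesis by (simp add: smooth_on_open_def)
qed

text \<open>Independence of the Hilbert-Schmidt norm from the orthonormal basis. It leads from the
  coordinate basis, used for the Laplacian, to one adapted to \<open>f\<close>.\<close>

lemma sum_norm_orthonormal_basis:
  fixes A :: "'a::euclidean_space \<Rightarrow> 'b::real_inner"
  assumes A: "linear A" and B: "finite B" "pairwise orthogonal B" "\<And>u. u \<in> B \<Longrightarrow> norm u = 1" "span B = UNIV"
  shows "(\<Sum>e\<in>Basis. A e \<bullet> A e) = (\<Sum>u\<in>B. A u \<bullet> A u)"
proof -
  have expand: "A e = (\<Sum>u\<in>B. (e \<bullet> u) *\<^sub>R A u)" for e
  proof -
    have "A e = A (\<Sum>u\<in>B. (e \<bullet> u) *\<^sub>R u)"
      using orthonormal_basis_expand[of B e] B by simp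
    then show ?thesis using A by (simp add: linear_sum linear_cmul)
  qed
  have "(\<Sum>e\<in>Basis. A e \<bullet> A e) = (\<Sum>e\<in>Basis. \<Sum>u\<in>B. \<Sum>v\<in>B. (u \<bullet> e) * (v \<bullet> e) * (A u \<bullet> A v))"
    by (subst (1 2) expand) (simp add: inner_sum_left inner_sum_right inner_commute mult_ac sum_distrib_left)
  also have "\<dots> = (\<Sum>u\<in>B. \<Sum>v\<in>B. \<Sum>e\<in>Basis. (u \<bullet> e) * (v \<bullet> e) * (A u \<bullet> A v))"
    by (subst sum.swap) (intro sum.cong refl sum.swap)
  also have "\<dots> = (\<Sum>u\<in>B. \<Sum>v\<in>B. (u \<bullet> v) * (A u \<bullet> A v))"
    by (simp add: sum_distrib_right[symmetric] euclidean_inner[symmetric])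
  also have "\<dots> = (\<Sum>u\<in>B. \<Sum>v\<in>B. if u = v then A u \<bullet> A u else 0)"
    using B(2,3) by (intro sum.cong refl) (auto simp: pairwise_def orthogonal_def norm_eq_1)
  also have "\<dots> = (\<Sum>u\<in>B. A u \<bullet> A u)" using B(1) by simp
  finally show ?thesis .
qed

text \<open>
  For the harmonic polynomials \<open>P b\<close> extending the components of \<open>f\<close>, homogeneity gives
  \<open>(\<Sum>b. (P b y)\<^sup>2) = |y|^(2k)\<close>; comparing the Laplacians of both sides gives the
  sum of the squares of the partial derivatives.
\<close>

lemma harmonic_extension:
  fixes f :: "'a::euclidean_space \<Rightarrow> 'b::euclidean_space" and k :: nat
  assumes maps: "f ` sphere 0 1 \<subseteq> sphere 0 1"
    and harm: "\<forall>b\<in>Basis. spherical_harmonic k (\<lambda>x. f x \<bullet> b)"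
    and k: "2 \<le> k" and x: "norm x = 1"
  obtains F where "smooth_on_open UNIV F" "\<And>y. norm y = 1 \<Longrightarrow> F y = f y"
    "frechet_derivative F (at x) x = real k *\<^sub>R f x"
    "(\<Sum>e\<in>Basis. frechet_derivative F (at x) e \<bullet> frechet_derivative F (at x) e) = k * (2 * k + DIM('a) - 2)"
proof -
  obtain P where "\<forall>b\<in>Basis. real_polynomial_function (P b) \<and> (\<forall>t y. P b (t *\<^sub>R y) = t ^ k * P b y) \<and>
      (\<forall>y. laplacian (P b) y = 0) \<and> (\<forall>y\<in>sphere 0 1. f y \<bullet> b = P b y)"
    using bchoice[OF harm[unfolded spherical_harmonic_def]] by blast
  then have P: "\<And>b. b \<in> Basis \<Longrightarrow> real_polynomial_function (P b)"
    "\<And>b t y. b \<in> Basis \<Longrightarrow> P b (t *\<^sub>R y) = t ^ k * P b y"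
    "\<And>b y. b \<in> Basis \<Longrightarrow> laplacian (P b) y = 0"
    "\<And>b y. b \<in> Basis \<Longrightarrow> norm y = 1 \<Longrightarrow> f y \<bullet> b = P b y"
    by auto
  have "\<forall>b\<in>Basis. \<exists>P'. (\<forall>y. (P b has_derivative P' y) (at y)) \<and> (\<forall>v. real_polynomial_function (\<lambda>y. P' y v))"
    using real_polynomial_function_derivative P(1) by blast
  from bchoice[OF this] obtain P' where
    P': "\<And>b y. b \<in> Basis \<Longrightarrow> (P b has_derivative P' b y) (at y)"
    "\<And>b v. b \<in> Basis \<Longrightarrow> real_polynomial_function (\<lambda>y. P' b y v)" by blast
  define P'' where "P'' b v y = frechet_derivative (\<lambda>z. P' b z v) (at y)" for b v y
  have P'': "((\<lambda>z. P' b z v) has_derivative P'' b v y) (at y)" if "b \<in> Basis" for b v y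
    unfolding P''_def
    using smooth_on_open_has_derivative[OF smooth_on_open_real_polynomial_function[OF P'(2)[OF that]]] by blast
  have fP': "frechet_derivative (P b) (at y) = P' b y" if "b \<in> Basis" for b y
    using frechet_derivative_at[OF P'(1)[OF that]] by simp
  have lap: "(\<Sum>e\<in>Basis. P'' b e x e) = 0" if "b \<in> Basis" for b
    using P(3)[OF that, of x] fP'[OF that] by (simp add: laplacian_def P''_def)
  define F where "F y = (\<Sum>b\<in>Basis. P b y *\<^sub>R b)" for y
  have F_smooth: "smooth_on_open UNIV F"
  proof -
    have "smooth_on_open UNIV (\<lambda>y. P b y *\<^sub>R b)" if "b \<in> Basis" for b
      by (rule smooth_on_open_linear[OF smooth_on_open_real_polynomial_function[OF P(1)[OF that]] bounded_linear_scaleR_left])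
    then show ?thesis unfolding F_def smooth_on_open_def by (auto intro!: Ck_on_sum)
  qed
  have F_f: "F y = f y" if "norm y = 1" for y
    using P(4)[OF _ that] euclidean_representation[of "f y"] by (simp add: F_def)
  have "(F has_derivative (\<lambda>v. \<Sum>b\<in>Basis. P' b x v *\<^sub>R b)) (at x)"
    unfolding F_def by (intro has_derivative_sum has_derivative_scaleR_left P'(1))
  then have DF: "frechet_derivative F (at x) = (\<lambda>v. \<Sum>b\<in>Basis. P' b x v *\<^sub>R b)"
    by (rule frechet_derivative_at[symmetric])
  \<comment> \<open>Euler's identity, by differentiating the homogeneity relation in
    \<open>t\<close> at \<open>t = 1\<close>.\<close>
  have "P' b x x = k * P b x" if b: "b \<in> Basis" for b
  proof -
    have "((\<lambda>t::real. t *\<^sub>R x) has_derivative (\<lambda>h. h *\<^sub>R x)) (at 1)" by (auto intro!: derivative_eq_intros)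
    from diff_chain_at[OF this, of "P b" "P' b x"] P'(1)[OF b, of x]
    have "((\<lambda>t. P b (t *\<^sub>R x)) has_derivative (\<lambda>h. P' b x (h *\<^sub>R x))) (at 1)" by (simp add: o_def)
    moreover have "((\<lambda>t. P b (t *\<^sub>R x)) has_derivative (\<lambda>h. k * h * P b x)) (at 1)"
      unfolding P(2)[OF b] by (auto intro!: derivative_eq_intros)
    ultimately have "(\<lambda>h::real. P' b x (h *\<^sub>R x)) = (\<lambda>h::real. k * h * P b x)" by (rule has_derivative_unique)
    from fun_cong[OF this, of 1] show ?thesis by simp
  qed
  then have Euler: "frechet_derivative F (at x) x = real k *\<^sub>R f x"
    unfolding DF F_f[OF x, symmetric] by (simp add: F_def scaleR_sum_right)
  define Q where "Q y = (\<Sum>b\<in>Basis. (P b y)\<^sup>2)" for y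
  have Q: "Q y = (y \<bullet> y) ^ k" for y
  proof (cases "y = 0")
    case True
    have "P b 0 = 0" if "b \<in> Basis" for b using P(2)[OF that, of 0 0] k by (auto simp: power_0_left)
    then show ?thesis using True k by (simp add: Q_def)
  next
    case False
    have "norm (sgn y) = 1" using False by (simp add: norm_sgn)
    have "P b y = norm y ^ k * (f (sgn y) \<bullet> b)" if "b \<in> Basis" for b
      using P(2)[OF that, of "norm y" "sgn y"] P(4)[OF that \<open>norm (sgn y) = 1\<close>] False by (simp add: sgn_div_norm)
    then have "Q y = (\<Sum>b\<in>Basis. (norm y ^ k)\<^sup>2 * ((f (sgn y) \<bullet> b) * (f (sgn y) \<bullet> b)))"
      unfolding Q_def by (simp add: power_mult_distrib power2_eq_square mult_ac)
    also have "\<dots> = (norm y ^ k)\<^sup>2 * (f (sgn y) \<bullet> f (sgn y))"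
      unfolding sum_distrib_left[symmetric] euclidean_inner[symmetric] ..
    also have "f (sgn y) \<bullet> f (sgn y) = 1"
      using maps \<open>norm (sgn y) = 1\<close> by (auto simp: image_subset_iff norm_eq_1)
    finally show ?thesis by (simp add: dot_square_norm power_mult[symmetric] mult.commute)
  qed
  \<comment> \<open>Both forms of \<open>Q\<close> are differentiated at every \<open>y\<close>, so
    that the resulting identity can be differentiated again.\<close>
  have dQ1: "(Q has_derivative (\<lambda>v. \<Sum>b\<in>Basis. 2 * P b y * P' b y v)) (at y)" for y
    unfolding Q_def by (auto intro!: derivative_eq_intros P'(1) sum.cong simp: mult_ac)
  have dQ2: "(Q has_derivative (\<lambda>v. 2 * k * ((y \<bullet> y) ^ (k - 1) * (y \<bullet> v)))) (at y)" for y
    unfolding Q by (auto intro!: derivative_eq_intros simp: inner_commute mult_ac)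
  have dQ: "(\<Sum>b\<in>Basis. 2 * P b y * P' b y v) = 2 * k * ((y \<bullet> y) ^ (k - 1) * (y \<bullet> v))" for y v
    using fun_cong[OF has_derivative_unique[OF dQ1 dQ2]] .
  \<comment> \<open>Second derivatives in direction \<open>e\<close> at the unit vector
    \<open>x\<close>. Summed over \<open>e\<close>, the \<open>P''\<close> terms become Laplacians
    and vanish.\<close>
  have "2 * (\<Sum>b\<in>Basis. P b x * P'' b e x e + P' b x e * P' b x e)
      = 2 * k * (2 * (real k - 1) * ((x \<bullet> e) * (x \<bullet> e)) + e \<bullet> e)" for e
  proof -
    have 1: "((\<lambda>y. \<Sum>b\<in>Basis. 2 * P b y * P' b y e) has_derivative
        (\<lambda>v. \<Sum>b\<in>Basis. 2 * (P b x * P'' b e x v + P' b x v * P' b x e))) (at x)"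
      by (intro has_derivative_sum) (auto intro!: derivative_eq_intros P'(1) P'' simp: algebra_simps)
    have 2: "((\<lambda>y. 2 * k * ((y \<bullet> y) ^ (k - 1) * (y \<bullet> e))) has_derivative
        (\<lambda>v. 2 * k * ((x \<bullet> x) ^ (k - 1) * (v \<bullet> e) + real (k - 1) * (2 * (x \<bullet> v)) * (x \<bullet> x) ^ (k - 2) * (x \<bullet> e)))) (at x)"
      by (auto intro!: derivative_eq_intros simp: inner_commute algebra_simps numeral_2_eq_2)
    have "x \<bullet> x = 1" using x by (simp add: norm_eq_1)
    with fun_cong[OF has_derivative_unique[OF 1[unfolded dQ] 2], of e] k show ?thesis
      by (simp add: sum_distrib_left of_nat_diff algebra_simps)
  qed
  then have "(\<Sum>e\<in>Basis. 2 * (\<Sum>b\<in>Basis. P b x * P'' b e x e + P' b x e * P' b x e))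
      = (\<Sum>e\<in>Basis. 2 * k * (2 * (real k - 1) * ((x \<bullet> e) * (x \<bullet> e)) + e \<bullet> e))" by (intro sum.cong refl)
  also have "\<dots> = 2 * k * (2 * (real k - 1) * (x \<bullet> x) + DIM('a))"
    by (simp add: sum_distrib_left[symmetric] sum.distrib euclidean_inner[symmetric])
  also have "\<dots> = 2 * (k * (2 * real k + DIM('a) - 2))" using x by (simp add: norm_eq_1 algebra_simps)
  also have "(\<Sum>e\<in>Basis. 2 * (\<Sum>b\<in>Basis. P b x * P'' b e x e + P' b x e * P' b x e))
      = 2 * ((\<Sum>b\<in>Basis. P b x * (\<Sum>e\<in>Basis. P'' b e x e)) + (\<Sum>e\<in>Basis. \<Sum>b\<in>Basis. P' b x e * P' b x e))"
  proof -
    have "(\<Sum>e\<in>Basis. \<Sum>b\<in>Basis. P b x * P'' b e x e) = (\<Sum>b\<in>Basis. P b x * (\<Sum>e\<in>Basis. P'' b e x e))"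
      by (subst sum.swap) (simp add: sum_distrib_left)
    then show ?thesis by (simp only: sum_distrib_left[symmetric] sum.distrib)
  qed
  also have "(\<Sum>b\<in>Basis. P b x * (\<Sum>e\<in>Basis. P'' b e x e)) = 0" using lap by simp
  also have "(\<Sum>e\<in>Basis. \<Sum>b\<in>Basis. P' b x e * P' b x e)
      = (\<Sum>e\<in>Basis. frechet_derivative F (at x) e \<bullet> frechet_derivative F (at x) e)"
    unfolding DF by (intro sum.cong refl) (simp add: inner_sum_left inner_sum_right inner_Basis if_distrib sum.delta cong: if_cong)
  finally have "(\<Sum>e\<in>Basis. frechet_derivative F (at x) e \<bullet> frechet_derivative F (at x) e) = k * (2 * k + DIM('a) - 2)"
    using k by (simp add: of_nat_diff)
  then show ?thesis by (intro that[OF F_smooth _ Euler]) (auto intro: F_f)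
qed

text \<open>Adding \<open>x\<close> to an adapted basis gives an orthonormal basis of the whole
  space. The sum in \<open>harmonic_extension\<close> then splits into \<open>k^2\<close> from
  \<open>x\<close>, by Euler's identity, 0 from the kernel, and \<open>lam^2\<close> from each
  vector of \<open>B1\<close>.\<close>

lemma harmonic_singular_value:
  fixes f :: "'a::euclidean_space \<Rightarrow> 'b::euclidean_space" and k n :: nat and lam :: real
  assumes maps: "f ` sphere 0 1 \<subseteq> sphere 0 1" and \<theta>: "0 < \<theta>" "\<theta> < pi / 2"
    and harm: "\<forall>b\<in>Basis. spherical_harmonic k (\<lambda>x. f x \<bullet> b)" and k: "2 \<le> k"
    and n: "DIM('a) = n + 1" and x: "norm x = 1"
    and sv: "singular_values f x = {0, lam}" and lam: "0 < lam"
  shows "dim (singular_space f x lam) * lam\<^sup>2 = k * (real k + n - 1)"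
proof -
  obtain F where F: "smooth_on_open UNIV F" "\<And>y. norm y = 1 \<Longrightarrow> F y = f y"
    "frechet_derivative F (at x) x = real k *\<^sub>R f x"
    "(\<Sum>e\<in>Basis. frechet_derivative F (at x) e \<bullet> frechet_derivative F (at x) e) = k * (2 * k + DIM('a) - 2)"
    using harmonic_extension[OF maps harm k x] by blast
  interpret LO_point f \<theta> x UNIV F
    using maps \<theta> x F by unfold_locales auto
  obtain B0 B1 where B: "finite B0" "finite B1" "B0 \<inter> B1 = {}" "pairwise orthogonal (B0 \<union> B1)"
    "\<forall>v\<in>B0 \<union> B1. norm v = 1" "span (B0 \<union> B1) = {y. y \<bullet> x = 0}"
    "card B1 = dim (singular_space f x lam)"
    "\<forall>v\<in>B0. DF v = 0" "\<forall>v\<in>B1. \<forall>w\<in>B1. DF v \<bullet> DF w = lam\<^sup>2 * (v \<bullet> w)"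
    by (rule adapted_basis[OF sv lam]) blast
  have orth: "v \<bullet> x = 0" if "v \<in> B0 \<union> B1" for v using span_base[OF that] unfolding B(6) by simp
  then have notin: "x \<notin> B0 \<union> B1" using x by (auto simp: norm_eq_1)
  have "y \<in> span (insert x (B0 \<union> B1))" for y
  proof -
    have "(y - (y \<bullet> x) *\<^sub>R x) \<bullet> x = 0" using x by (simp add: inner_diff_left norm_eq_1)
    then have "y - (y \<bullet> x) *\<^sub>R x \<in> span (B0 \<union> B1)" unfolding B(6) by simp
    then show ?thesis unfolding span_insert by blast
  qed
  then have "span (insert x (B0 \<union> B1)) = UNIV" by blast
  moreover have "pairwise orthogonal (insert x (B0 \<union> B1))"
    using B(4) orth by (auto simp: pairwise_insert orthogonal_def inner_commute)
  ultimately have "k * (2 * k + DIM('a) - 2) = (\<Sum>u\<in>insert x (B0 \<union> B1). DF u \<bullet> DF u)"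
    unfolding F(4)[symmetric] using B(1,2,5) x by (intro sum_norm_orthonormal_basis linear_DF) auto
  also have "\<dots> = DF x \<bullet> DF x + (\<Sum>u\<in>B0 \<union> B1. DF u \<bullet> DF u)"
    using notin B(1,2) by simp
  also have "(\<Sum>u\<in>B0 \<union> B1. DF u \<bullet> DF u) = (\<Sum>u\<in>B0. DF u \<bullet> DF u) + (\<Sum>u\<in>B1. DF u \<bullet> DF u)"
    by (rule sum.union_disjoint[OF B(1-3)])
  also have "(\<Sum>u\<in>B0. DF u \<bullet> DF u) = 0" using B(8) by simp
  also have "(\<Sum>u\<in>B1. DF u \<bullet> DF u) = (\<Sum>u\<in>B1. lam\<^sup>2)" using B(5,9) by (intro sum.cong) (auto simp: norm_eq_1)
  also have "DF x \<bullet> DF x = (real k)\<^sup>2" unfolding F(3) using norm_f[OF x(1)] by (simp add: norm_eq_1 power2_eq_square)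
  finally have "k * (2 * real k + n - 1) = (real k)\<^sup>2 + dim (singular_space f x lam) * lam\<^sup>2"
    using n k B(7) by (simp add: of_nat_diff)
  then show ?thesis by (simp add: algebra_simps power2_eq_square)
qed

section \<open>The length-minimizing property\<close>

theorem mainTheorem4:
  fixes f :: "'a::euclidean_space \<Rightarrow> 'b::euclidean_space"
    and n m p :: nat and \<theta> lam :: real
  assumes "DIM('a) = n + 1" and "DIM('b) = m + 1"
    and "LOMSE f"
    and "LOM_angle f \<theta>"
    and "LOMSE_singular_value f lam p"
    and "LOMSE_type_I f n p"
  shows "\<exists>\<phi>\<^sub>1 > tan \<theta>.
    ray_length_minimizing_in
      (canonical_metric (sphere_measure (sphere (0::'a) 1)) lam n p)
      (LOC_curve \<theta>) (angular_region \<phi>\<^sub>1)"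
proof -
  have \<theta>: "0 < \<theta>" "\<theta> < pi / 2" and min: "minimal_submanifold_of_sphere (DIM('a) - 1) (LO_submanifold f \<theta>)"
    using assms(4) unfolding LOM_angle_def by blast+
  have lam: "0 < lam" using assms(5) unfolding LOMSE_singular_value_def by blast
  obtain x where "x \<in> sphere 0 1" and sv: "singular_values f x = {0, lam}"
    and p: "p = dim (singular_space f x lam)"
    using assms(5) unfolding LOMSE_singular_value_def by blast
  then have x: "norm x = 1" by simp
  have maps: "f ` sphere 0 1 \<subseteq> sphere 0 1" and "smooth_map_on (sphere 0 1) f"
    using assms(3) unfolding LOMSE_def LOM_def by blast+
  then obtain U F where "x \<in> U" "smooth_on_open U F" "\<forall>y\<in>sphere 0 1 \<inter> U. F y = f y"
    using \<open>x \<in> sphere 0 1\<close> unfolding smooth_map_on_def by blast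
  then interpret LO_point f \<theta> x U F
    using maps \<theta> x by unfold_locales auto
  note rel = angle_relation[OF min sv lam assms(1) p]
  have tan: "0 < tan \<theta>" using \<theta> by (intro tan_gt_zero)
  have \<sigma>: "0 \<le> sphere_measure (sphere (0::'a) 1)" by (simp add: sphere_measure_def)
  have q: "real n = real p + real (n - p)" using rel(2) by simp
  define calibrated where "calibrated s z \<longleftrightarrow>
      exp ((2 * s - 1) * (p * ln (1 + z / p) + real (n - p) * ln (1 - z / real (n - p)))) *
      (1 + s\<^sup>2 * (4 * (real n)\<^sup>2 / (real n + 1)\<^sup>2) * z\<^sup>2 * (p + z - n / lam\<^sup>2) / ((p + z)\<^sup>2 * (real (n - p) - z))) \<le> 1"
    for s z :: real
  \<comment> \<open>For \<open>n \<ge> 7\<close> the inequality holds for all relevant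
    \<open>z\<close> and the bound 1 is an arbitrary choice; in the exceptional types it is
    1/10.\<close>
  obtain s \<delta> where s: "0 < \<delta>"
    "\<And>z. n / lam\<^sup>2 - p < z \<Longrightarrow> z < \<delta> \<Longrightarrow> - real p < z \<Longrightarrow> z < real (n - p) \<Longrightarrow> calibrated s z"
  proof (cases "n \<ge> 7")
    case True
    have s: "2 * (6 / 5) - 1 = (7 / 5 :: real)" by simp
    have "calibrated (6 / 5) z" if z: "- real p < z" "z < real (n - p)" for z
      unfolding calibrated_def s
      by (rule calibration_inequality_large[OF _ _ _ q z]) (use rel(1,2) True in auto)
    then show thesis using that[of 1 "6/5"] by simp
  next
    case False
    then obtain k where k: "LOMSE_of_type f n p k" "(n, p, k) \<in> {(3, 2, 2), (5, 4, 2), (5, 4, 4)}"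
      using assms(6) by (auto simp: LOMSE_type_I_def)
    have harm: "\<forall>b\<in>Basis. spherical_harmonic k (\<lambda>x. f x \<bullet> b)" using k(1) by (simp add: LOMSE_of_type_def)
    have "2 \<le> k" using k(2) by auto
    from harmonic_singular_value[OF maps \<theta> harm this assms(1) x(1) sv lam]
    have pk: "p * lam\<^sup>2 = k * (real k + n - 1)" by (simp only: p)
    have np: "n - p = 1" using k(2) by auto
    \<comment> \<open>In the order of the list, \<open>pk\<close> gives \<open>lam\<^sup>2\<close>
      as 4, 3, 8 and \<open>n / lam\<^sup>2\<close> as 3/4, 5/3, 5/8.\<close>
    have b: "p = 2 \<and> n / lam\<^sup>2 = 3 / 4 \<or> p = 4 \<and> 5 / 8 \<le> n / lam\<^sup>2"
    proof -
      consider "n = 3" "p = 2" "k = 2" | "n = 5" "p = 4" "k = 2" | "n = 5" "p = 4" "k = 4" using k(2) by auto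
      then show ?thesis
      proof cases
        case 1
        then have "lam\<^sup>2 = 4" using pk by simp
        then show ?thesis using 1 by simp
      next
        case 2
        then have "lam\<^sup>2 = 3" using pk by simp
        then show ?thesis using 2 by simp
      next
        case 3
        then have "lam\<^sup>2 = 8" using pk by simp
        then show ?thesis using 3 by simp
      qed
    qed
    have n1: "real n = real p + 1" using q np by simp
    have "calibrated 1 z" if z: "n / lam\<^sup>2 - p < z" "z < 1 / 10" "- real p < z" for z
      using calibration_inequality_small[OF b n1 z(1) less_imp_le[OF z(2)] z(3)]
      by (simp add: calibrated_def np)
    then show thesis using that[of "1/10" 1] by simp
  qed
  show ?thesis
    unfolding LOC_curve_def
    by (rule canonical_metric_ray_minimizing[OF rel(1,2) lam \<sigma> tan rel(3) s(1) s(2)[unfolded calibrated_def]])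
qed

end
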